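(* Assume (A1)–(A6) of the context. For $j\ge1$, consider the closed-loop system $x_{k+1}^j=Ax_k^j+B\pi^{j\star}(x_k^j)+w_k^j$, $x_0^j=x_S$, $w_k^j\sim p(w)$, controlled by the MPC policy $\pi^{j\star}$ of episode $j$. Then $$\lim_{k\to\infty}\mathbb P(x_k^j\in\mathcal O)=1 .$$
   Context: System and constraints. $x_{k+1}=Ax_k+Bu_k+w_k$, $x_k\in\mathbb R^{n_x}$, $u_k\in\mathbb R^{n_u}$, $A,B$ known; constraints $x_k\in\mathcal X=\{x: H_xx\le h_x\}$ (a polyhedron), $u_k\in\mathcal U=\{u: H_uu\le h_u\}$ (a nonempty polytope). Notation: $\mathcal S\ominus\mathcal Y=\{x\in\mathcal S: x+y\in\mathcal S\ \forall y\in\mathcal Y\}$, $\oplus$ is the Minkowski sum, $[\cdot]_i$ is the $i$-th column (or component). The control task is repeated in episodes $j=0,1,2,\dots$, each starting at $x_0^j=x_S$ and ending at a time $T^j$ with $x^j_{T^j}\in\mathcal O$. (A1) The $w_k$ are i.i.d., zero mean, with known distribution $p(w)$ and support $\mathcal W=\{w: H_ww\le h_w\}$, a nonempty polytope with the origin in its interior and vertices $v_1^{\mathcal W},\dots,v_{l_w}^{\mathcal W}$. (A2) $x_S\in\mathcal X$. (A3) $\mathcal O\subseteq\mathcal X$ is a polytope with nonempty relative interior and vertices $v_1^{\mathcal O},\dots,v_{l_{\mathcal O}}^{\mathcal O}$, and is robust positive invariant for $x_{k+1}=(A+BK)x_k+w_k$, $w_k\in\mathcal W$, where $K$ is a given gain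 with $A+BK$ stable (all eigenvalues in the open unit disc). Put $\mathcal{KO}=\{Kx: x\in\mathcal O\}$. (A4) The stage cost $\ell:\mathcal X\times\mathcal U\to\mathbb R$ is differentiable and jointly convex, $\ell(x,u)=0$ for all $x\in\mathcal O$, $u\in\mathcal{KO}$, and $\ell(x,u)>0$ for all $x\in\mathcal X\setminus\mathcal O$, $u\in\mathcal U\setminus\mathcal{KO}$. Discretized disturbances. $\tilde w_1,\dots,\tilde w_M\in\mathcal W$ are sample points including all vertices of $\mathcal W$. For each $w\in\mathcal W$ convex coefficients $\mu_m(w)\ge0$, $\sum_m\mu_m(w)=1$, with $w=\sum_{m=1}^M\mu_m(w)\tilde w_m$ are fixed, and $p_m=\mathbb E_w[\mu_m(w)]$. (A5) For each $w\in\mathcal W$ there is $\delta(w,M)>0$ with $\|w-\tilde w_m\|\le\delta(w,M)$ for every $m$ with $\mu_m(w)\ne0$; and if, starting from $M_1$ samples, further disturbances are sampled in $\mathcal W$ keeping the earlier ones, then there is $N>M_1$ such that $\delta(w,M_1)>\delta(w,M_2)$ for all $M_2\ge N$. Initialization. (A6) A sub-optimal (feasible) controller for the problem of minimizing $\mathbb E[\sum_{k\ge0}\ell(x_k,\pi(x_k))]$ over state feedback policies, subject to the dynamics from $x_S$ and the constraints for all disturbance realizations, is available and ends the episode in finite time. It is taken to be a tube controller: $\mathcal E$ is a polytopic robust positive invariant set for $x_{k+1}=(A+BK)x_k+w_k$, $w_k\in\mathcal W$; nominal sequences satisfy $\bar x_{k+1}=A\bar x_k+B\bar u_k$, $\bar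 x_0=x_S$, $\bar x_{k+1}\in\mathcal X\ominus\mathcal E$, $\bar u_k\in\mathcal U\ominus K\mathcal E$ for $0\le k\le T_0$, $\bar x_{T_0+1}\in\mathcal O\ominus\mathcal E$; $\pi_{\rm Tube}(x)=\bar u_k+K(x-\bar x_k)$ at time $k$; $\mathcal E_k=\bar x_k\oplus\mathcal E$, $0\le k\le T_0+1$. The columns of $\mathbf X^0$ are the vertices of $\mathcal O$ and of $\mathcal E_0,\dots,\mathcal E_{T_0+1}$. The columns of $\mathbf U^0$ are the corresponding inputs: $\pi_{\rm Tube}(v)$ for a vertex $v$ of $\mathcal E_k$, $k\le T_0$, and $Kv$ for vertices of $\mathcal O$ and $\mathcal E_{T_0+1}\subseteq\mathcal O$. The entries of the row vector $\mathbf J^0$ are $0$ for vertices of $\mathcal O$ and $J_k^0$ for vertices of $\mathcal E_k$, where $J^0_{T_0+1}=0$ and $J_k^0=\max_{x\in\mathcal E_k}\ell(x,\pi_{\rm Tube}(x))+J_{k+1}^0$. Safe set and value function. For $j\ge0$, $\mathcal{SS}^j$ is the convex hull of the columns of $\mathbf X^j$, and for $x\in\mathcal{SS}^j$ $$Q^j(x)=\min_{\lambda}\{\mathbf J^j\lambda:\ \mathbf X^j\lambda=x,\ \lambda\ge0,\ \mathbf 1^\top\lambda=1\}.$$ MPC. For $j\ge1$, $$\hat V^j(x)=\min_u\ \ell(x,u)+\sum_{m=1}^Mp_mQ^{j-1}(Ax+Bu+\tilde w_m)\quad\text{s.t. }x\in\mathcal X,\ u\in\mathcal U,\ Ax+Bu\in\mathcal{SS}^{j-1}\ominus\mathcal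 W,$$ and $\pi^{j\star}(x)$ denotes an optimal input; in episode $j$ the input $u_k^j=\pi^{j\star}(x_k^j)$ is applied. Data update after episode $j\ge1$. For each $k=0,\dots,T^j$ exploration yields states $x_1^{\mathcal W\star},\dots,x_{l_w}^{\mathcal W\star}$ (depending on $k,j$), as follows. Write $\mathcal{SS}^{j-1}\ominus\mathcal W=\{x: Hx\le h\}$, let $f_k^j(u)=\ell(x_k^j,u)+\sum_mp_mQ^{j-1}(Ax_k^j+Bu+\tilde w_m)$, let $u^\star=\pi^{j\star}(x_k^j)$, and let $\nu,\gamma\ge0$ be optimal multipliers of $H(Ax_k^j+Bu)\le h$ and $H_uu\le h_u$. If $\nu\neq0$, maximize $\nu^\top HBd$ over $d\in\mathbb R^{n_u}$ and $u_1^{\mathcal W},\dots,u_{l_w}^{\mathcal W}$ subject to $\nabla f_k^j(u^\star)^\top d\le0$, $Ax_k^j+B(u^\star+d)\in\mathcal X\ominus\mathcal W$, $u^\star+d\in\mathcal U$, and, for all $i$, $x_i^{\mathcal W}=Ax_k^j+B(u^\star+d)+v_i^{\mathcal W}$, $Ax_i^{\mathcal W}+Bu_i^{\mathcal W}\in\mathcal{SS}^{j-1}\ominus\mathcal W$, $u_i^{\mathcal W}\in\mathcal U$; the $x_i^{\mathcal W\star}$ are the optimal $x_i^{\mathcal W}$. If $\nu=0$, the $x_i^{\mathcal W\star}$ are sampled from a Gaussian with mean $x_k^j$ and identity covariance truncated to $\mathcal{SS}^{j-1}$. Then $\mathbf X^j$ is $\mathbf X^{j-1}$ with the columns $x_0^j,\dots,x_{T^j}^j$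 and all explored states appended; $\mathbf U^j$ and $\mathbf J^j$ are $\mathbf U^{j-1}$ and $\mathbf J^{j-1}$ with $\pi^{j\star}(x)$ and $\hat V^j(x)$ appended for each appended state $x$.
   Formalization: In (A4), positivity is assumed as ℓ(x,u)>0 for all x∈X∖O and every u∈U, not only u∈U∖KO; with the literal wording the claim fails, e.g. for ℓ(x,u)=dist(u,KO)², where an optimal policy may keep the state away from O forever. *)

theory Defs
  imports "HOL-Probability.Probability"
begin

definition pontryagin_diff :: "'a::ab_group_add set \<Rightarrow> 'a set \<Rightarrow> 'a set"  (infixl "\<ominus>" 65) where
  "S \<ominus> Y = {x \<in> S. \<forall>y\<in>Y. x + y \<in> S}"

definition vertices :: "'a::real_vector set \<Rightarrow> 'a set" where
  "vertices S = {v. v extreme_point_of S}"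

definition robust_invariant :: "real^'n^'n \<Rightarrow> (real^'n) set \<Rightarrow> (real^'n) set \<Rightarrow> bool" where
  "robust_invariant F W S \<longleftrightarrow> (\<forall>x\<in>S. \<forall>w\<in>W. F *v x + w \<in> S)"

definition schur_stable :: "real^'n^'n \<Rightarrow> bool" where
  "schur_stable F \<longleftrightarrow>
     (\<forall>(z::complex) (v::complex^'n).
        v \<noteq> 0 \<and> (\<chi> i j. complex_of_real (F $ i $ j)) *v v = z *s v \<longrightarrow> cmod z < 1)"

definition measure_support :: "'a::topological_space measure \<Rightarrow> 'a set" where
  "measure_support p = {x. \<forall>V. open V \<and> x \<in> V \<longrightarrow> 0 < emeasure p V}"

primrec closed_loop ::
  "real^'n^'n \<Rightarrow> real^'u^'n \<Rightarrow> (real^'n \<Rightarrow> real^'u) \<Rightarrow> real^'n \<Rightarrow> (nat \<Rightarrow> real^'n) \<Rightarrow> nat \<Rightarrow> real^'n"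
where
  "closed_loop A B \<pi> x0 w 0 = x0"
| "closed_loop A B \<pi> x0 w (Suc k) =
     A *v closed_loop A B \<pi> x0 w k + B *v \<pi> (closed_loop A B \<pi> x0 w k) + w k"

text \<open>
  The three data matrices are kept together as one finite set of columns: an element
  \<open>(x, u, c)\<close> is a stored state, its input and its cost entry.
  Neither the safe set nor the value function depends on the order or multiplicity of columns.
\<close>

type_synonym ('n, 'u) column = "(real^'n) \<times> (real^'u) \<times> real"

definition safe_set :: "('n, 'u) column set \<Rightarrow> (real^'n) set" where
  "safe_set D = convex hull (fst ` D)"

text \<open>
  The infimum is a minimum for \<open>x\<close> in the safe set of a finite \<open>D\<close>
  (and unspecified elsewhere).
\<close>

definition Q_fun :: "('n, 'u) column set \<Rightarrow> real^'n \<Rightarrow> real" where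
  "Q_fun D x = Inf {(\<Sum>c\<in>D. lam c * snd (snd c)) | lam.
     (\<Sum>c\<in>D. lam c *\<^sub>R fst c) = x \<and> (\<forall>c\<in>D. 0 \<le> lam c) \<and> (\<Sum>c\<in>D. lam c) = 1}"

definition mpc_objective ::
  "real^'n^'n \<Rightarrow> real^'u^'n \<Rightarrow> (real^'n \<Rightarrow> real^'u \<Rightarrow> real) \<Rightarrow> nat \<Rightarrow> (nat \<Rightarrow> real) \<Rightarrow> (nat \<Rightarrow> real^'n) \<Rightarrow>
   ('n, 'u) column set \<Rightarrow> real^'n \<Rightarrow> real^'u \<Rightarrow> real"
where
  "mpc_objective A B l M pm wt D x u =
     l x u + (\<Sum>m<M. pm m * Q_fun D (A *v x + B *v u + wt m))"

definition mpc_inputs ::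
  "real^'n^'n \<Rightarrow> real^'u^'n \<Rightarrow> (real^'n) set \<Rightarrow> (real^'u) set \<Rightarrow> (real^'n) set \<Rightarrow>
   ('n, 'u) column set \<Rightarrow> real^'n \<Rightarrow> (real^'u) set"
where
  "mpc_inputs A B X U W D x =
     {u. x \<in> X \<and> u \<in> U \<and> A *v x + B *v u \<in> safe_set D \<ominus> W}"

definition mpc_value ::
  "real^'n^'n \<Rightarrow> real^'u^'n \<Rightarrow> (real^'n \<Rightarrow> real^'u \<Rightarrow> real) \<Rightarrow>
   (real^'n) set \<Rightarrow> (real^'u) set \<Rightarrow> (real^'n) set \<Rightarrow>
   nat \<Rightarrow> (nat \<Rightarrow> real) \<Rightarrow> (nat \<Rightarrow> real^'n) \<Rightarrow> ('n, 'u) column set \<Rightarrow> real^'n \<Rightarrow> real"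
where
  "mpc_value A B l X U W M pm wt D x =
     (INF u \<in> mpc_inputs A B X U W D x. mpc_objective A B l M pm wt D x u)"

text \<open>
  \<open>Q_fun\<close> is only piecewise linear, so the objective need not be differentiable in the input.
  Its gradient is therefore rendered by an arbitrary subgradient on the set where the objective
  is defined. In the interior of that set a point of differentiability has the gradient as its
  only subgradient.
\<close>

definition subgradient_on :: "'a::real_inner set \<Rightarrow> ('a \<Rightarrow> real) \<Rightarrow> 'a \<Rightarrow> 'a \<Rightarrow> bool" where
  "subgradient_on S f y g \<longleftrightarrow> (\<forall>z\<in>S. f y + g \<bullet> (z - y) \<le> f z)"

definition objective_dom ::
  "real^'n^'n \<Rightarrow> real^'u^'n \<Rightarrow> (real^'u) set \<Rightarrow> nat \<Rightarrow> (nat \<Rightarrow> real^'n) \<Rightarrow>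
   ('n, 'u) column set \<Rightarrow> real^'n \<Rightarrow> (real^'u) set"
where
  "objective_dom A B U M wt D x = {u \<in> U. \<forall>m<M. A *v x + B *v u + wt m \<in> safe_set D}"

text \<open>
  Karush-Kuhn-Tucker conditions at \<open>us\<close> for minimization subject to
  \<open>H i \<bullet> (A *v x + B *v u) \<le> h i\<close> for \<open>i < r\<close> and \<open>Hu *v u \<le> hu\<close>,
  where \<open>g\<close> is the (sub)gradient of the objective. The rows \<open>H i\<close> are indexed by
  naturals because their number varies with the safe set.
\<close>

definition optimal_multipliers ::
  "real^'n^'n \<Rightarrow> real^'u^'n \<Rightarrow> nat \<Rightarrow> (nat \<Rightarrow> real^'n) \<Rightarrow> (nat \<Rightarrow> real) \<Rightarrow>
   real^'u^'cu \<Rightarrow> real^'cu \<Rightarrow> real^'u \<Rightarrow> real^'n \<Rightarrow> real^'u \<Rightarrow>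
   (nat \<Rightarrow> real) \<Rightarrow> real^'cu \<Rightarrow> bool"
where
  "optimal_multipliers A B r H h Hu hu g x us \<nu> \<gamma> \<longleftrightarrow>
     (\<forall>i<r. 0 \<le> \<nu> i) \<and> 0 \<le> \<gamma> \<and>
     g + (\<Sum>i<r. \<nu> i *\<^sub>R (transpose B *v H i)) + transpose Hu *v \<gamma> = 0 \<and>
     (\<forall>i<r. \<nu> i * (H i \<bullet> (A *v x + B *v us) - h i) = 0) \<and>
     (\<forall>i. \<gamma> $ i * ((Hu *v us) $ i - hu $ i) = 0)"

text \<open>
  Feasible pairs of the exploration problem. The inputs \<open>uW\<close> (and below the explored
  states) are indexed by the vertices of \<open>W\<close> themselves.
\<close>

definition exploration_feasible ::
  "real^'n^'n \<Rightarrow> real^'u^'n \<Rightarrow> (real^'n) set \<Rightarrow> (real^'u) set \<Rightarrow> (real^'n) set \<Rightarrow>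
   ('n, 'u) column set \<Rightarrow> real^'u \<Rightarrow> real^'n \<Rightarrow> real^'u \<Rightarrow> ((real^'u) \<times> (real^'n \<Rightarrow> real^'u)) set"
where
  "exploration_feasible A B X U W D g x us =
     {(d, uW). g \<bullet> d \<le> 0 \<and>
        A *v x + B *v (us + d) \<in> X \<ominus> W \<and> us + d \<in> U \<and>
        (\<forall>v\<in>vertices W.
           A *v (A *v x + B *v (us + d) + v) + B *v uW v \<in> safe_set D \<ominus> W \<and> uW v \<in> U)}"

text \<open>
  \<open>explored \<dots> x us xW\<close>: the states \<open>xW v\<close>, for \<open>v\<close> a vertex of \<open>W\<close>, are a
  possible outcome of the exploration from the state \<open>x\<close> with optimal input \<open>us\<close>.
  For vanishing \<open>\<nu>\<close> they are realizations of a Gaussian truncated to the safe set, hence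
  may be any points of the safe set.
\<close>

definition explored ::
  "real^'n^'n \<Rightarrow> real^'u^'n \<Rightarrow> (real^'n \<Rightarrow> real^'u \<Rightarrow> real) \<Rightarrow>
   (real^'n) set \<Rightarrow> (real^'u) set \<Rightarrow> real^'u^'cu \<Rightarrow> real^'cu \<Rightarrow> (real^'n) set \<Rightarrow>
   nat \<Rightarrow> (nat \<Rightarrow> real) \<Rightarrow> (nat \<Rightarrow> real^'n) \<Rightarrow> ('n, 'u) column set \<Rightarrow>
   real^'n \<Rightarrow> real^'u \<Rightarrow> (real^'n \<Rightarrow> real^'n) \<Rightarrow> bool"
where
  "explored A B l X U Hu hu W M pm wt D x us xW \<longleftrightarrow>
     (\<exists>r H h g \<nu> \<gamma>.
        safe_set D \<ominus> W = {z. \<forall>i<r. H i \<bullet> z \<le> h i} \<and>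
        subgradient_on (objective_dom A B U M wt D x) (mpc_objective A B l M pm wt D x) us g \<and>
        optimal_multipliers A B r H h Hu hu g x us \<nu> \<gamma> \<and>
        (if \<exists>i<r. \<nu> i \<noteq> 0
         then \<exists>d uW.
                is_arg_max (\<lambda>(d, uW). \<Sum>i<r. \<nu> i * (H i \<bullet> (B *v d)))
                  (\<lambda>s. s \<in> exploration_feasible A B X U W D g x us) (d, uW) \<and>
                (\<forall>v\<in>vertices W. xW v = A *v x + B *v (us + d) + v)
         else \<forall>v\<in>vertices W. xW v \<in> safe_set D))"

end

theory Submission
  imports Defs
begin

text \<open>
  The stored data keep two properties from episode to episode: the stored inputs keep the state in
  the safe set, and the stored costs dominate the MPC objective. By convexity of \<open>Q_fun\<close> this makes
  \<open>Q_fun\<close> a stochastic Lyapunov function,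
  \<open>E Q(x\<^sub>k\<^sub>+\<^sub>1) \<le> E Q(x\<^sub>k) - E l(x\<^sub>k, u\<^sub>k)\<close>, vanishing exactly on the target set, which is
  therefore invariant under the MPC policy. The stage cost vanishes on the boundary of the target
  set, so this alone only yields that the distance of \<open>x\<^sub>k\<close> to the target tends to \<open>0\<close> in probability.
  The noise closes the gap: as a neighbourhood of \<open>0\<close> is in its support, from any state the next one
  lies in the target with probability at least \<open>\<beta>\<close>, or at distance at least \<open>r / 4\<close> from it
  with probability at least \<open>\<beta>\<close>. The second alternative gets rare, so the first one drives
  \<open>P (x\<^sub>k \<notin> target)\<close> to \<open>0\<close>. (If the target is all of the state constraint set, the stage cost
  may be negative, but then safety suffices.)
\<close>

section \<open>The value function of the stored data\<close>

lemma safe_set_eq_fst_convex_hull: "safe_set D = fst ` (convex hull D)"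
  unfolding safe_set_def by (rule convex_hull_linear_image[symmetric]) (rule linear_fst)

lemma convex_safe_set: "convex (safe_set D)"
  by (simp add: safe_set_def)

lemma compact_safe_set: "finite D \<Longrightarrow> compact (safe_set D)"
  by (simp add: safe_set_def finite_imp_compact_convex_hull)

lemma safe_set_mono: "D \<subseteq> D' \<Longrightarrow> safe_set D \<subseteq> safe_set D'"
  unfolding safe_set_def by (intro hull_mono image_mono)

text \<open>The coefficients \<open>lam\<close> are those of a point of the hull of \<open>D\<close>
  taken in the full space of states, inputs and costs, so \<open>Q_fun\<close> is the lower boundary
  of that polytope over the state. Keeping the input coordinate means that every interpolated cost
  comes with an interpolated input.\<close>

lemma Q_fun_eq_Inf_convex_hull:
  fixes D :: "('n::finite, 'u::finite) column set"
  assumes "finite D"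
  shows "Q_fun D x = Inf ((\<lambda>z. snd (snd z)) ` {z \<in> convex hull D. fst z = x})"
proof -
  have sum_eq: "(\<Sum>c\<in>D. lam c *\<^sub>R c) =
      (\<Sum>c\<in>D. lam c *\<^sub>R fst c, \<Sum>c\<in>D. lam c *\<^sub>R fst (snd c), \<Sum>c\<in>D. lam c * snd (snd c))" for lam
    by (simp add: prod_eq_iff fst_sum snd_sum)
  have "{(\<Sum>c\<in>D. lam c * snd (snd c)) | lam.
     (\<Sum>c\<in>D. lam c *\<^sub>R fst c) = x \<and> (\<forall>c\<in>D. 0 \<le> lam c) \<and> (\<Sum>c\<in>D. lam c) = 1}
     = (\<lambda>z. snd (snd z)) ` {z \<in> convex hull D. fst z = x}"
    unfolding convex_hull_finite[OF assms]
    by (force simp: sum_eq image_iff)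

  then show ?thesis by (simp add: Q_fun_def)
qed

lemma compact_fibre_convex_hull:
  fixes D :: "('a::euclidean_space \<times> 'b::euclidean_space) set"
  assumes "finite D" 
  shows "compact {z \<in> convex hull D. fst z = x}"
proof -
  have "closed {z::'a \<times> 'b. fst z = x}"
    by (intro closed_Collect_eq continuous_intros)
  with assms have "compact (convex hull D \<inter> {z. fst z = x})"
    by (intro compact_Int_closed finite_imp_compact_convex_hull)
  then show ?thesis by (simp add: Collect_conj_eq)
qed

lemma compact_fibre_costs:
  fixes D :: "('n::finite, 'u::finite) column set"
  assumes "finite D" 
  shows "compact ((\<lambda>z. snd (snd z)) ` {z \<in> convex hull D. fst z = x})"
  by (intro compact_continuous_image compact_fibre_convex_hull assms continuous_intros)

text \<open>The part of the hull over \<open>x\<close> is compact, so a lowest point exists. Its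
  input coordinate \<open>u\<close> is the candidate that the optimal MPC input is later compared
  with.\<close>

lemma Q_fun_attained:
  fixes D :: "('n::finite, 'u::finite) column set"
  assumes D: "finite D" and x: "x \<in> safe_set D"
  obtains u where "(x, u, Q_fun D x) \<in> convex hull D"
proof -
  let ?S = "(\<lambda>z. snd (snd z)) ` {z \<in> convex hull D. fst z = x}"
  have "?S \<noteq> {}" using x unfolding safe_set_eq_fst_convex_hull by fastforce
  moreover have "bdd_below ?S" "closed ?S"
    using compact_fibre_costs[OF D, of x] by (auto simp: compact_imp_closed compact_imp_bounded bounded_imp_bdd_below)
  ultimately have "Inf ?S \<in> ?S"
    by (rule closed_contains_Inf)
  then show ?thesis
    using that by (auto simp: Q_fun_eq_Inf_convex_hull[OF D])
qed

lemma Q_fun_le: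
  fixes D :: "('n::finite, 'u::finite) column set"
  assumes D: "finite D" and x: "(x, u, c) \<in> convex hull D"
  shows "Q_fun D x \<le> c"
  unfolding Q_fun_eq_Inf_convex_hull[OF D]
proof (rule cInf_lower)
  show "bdd_below ((\<lambda>z. snd (snd z)) ` {z \<in> convex hull D. fst z = x})"
    using compact_fibre_costs[OF D, of x] by (simp add: compact_imp_bounded bounded_imp_bdd_below)
qed (use x in force)

lemma convex_on_Q_fun:
  fixes D :: "('n::finite, 'u::finite) column set"
  assumes D: "finite D"
  shows "convex_on (safe_set D) (Q_fun D)"
proof (rule convex_onI)
  fix t x y assume t: "0 < t" "t < (1::real)" and x: "x \<in> safe_set D" and y: "y \<in> safe_set D"
  obtain u where u: "(x, u, Q_fun D x) \<in> convex hull D" using Q_fun_attained[OF D x] .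
  obtain v where v: "(y, v, Q_fun D y) \<in> convex hull D" using Q_fun_attained[OF D y] .
  have "(1 - t) *\<^sub>R (x, u, Q_fun D x) + t *\<^sub>R (y, v, Q_fun D y) \<in> convex hull D"
    using u v t by (intro convexD convex_convex_hull) auto
  from Q_fun_le[OF D this[simplified]]
  show "Q_fun D ((1 - t) *\<^sub>R x + t *\<^sub>R y) \<le> (1 - t) * Q_fun D x + t * Q_fun D y" by simp
qed (rule convex_safe_set)

lemma Q_fun_antimono:
  fixes D :: "('n::finite, 'u::finite) column set"
  assumes D: "finite D'" "D \<subseteq> D'" and x: "x \<in> safe_set D"
  shows "Q_fun D' x \<le> Q_fun D x"
proof -
  obtain u where "(x, u, Q_fun D x) \<in> convex hull D"
    using Q_fun_attained[OF finite_subset[OF D(2,1)] x] .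
  then show ?thesis using hull_mono[OF D(2)] by (intro Q_fun_le D(1)) blast
qed

text \<open>The sublevel set is the projection of the compact polytope cut by a half-space in the
  cost coordinate. Measurability follows from this without any continuity argument for
  \<open>Q_fun\<close>.\<close>

lemma compact_Q_fun_sublevel:
  fixes D :: "('n::finite, 'u::finite) column set"
  assumes D: "finite D"
  shows "compact {x \<in> safe_set D. Q_fun D x \<le> t}"
proof -
  have "{x \<in> safe_set D. Q_fun D x \<le> t} = fst ` (convex hull D \<inter> {z. snd (snd z) \<le> t})"
  proof (intro set_eqI iffI)
    fix x assume "x \<in> {x \<in> safe_set D. Q_fun D x \<le> t}"
    then obtain u where "(x, u, Q_fun D x) \<in> convex hull D" "Q_fun D x \<le> t"
      using Q_fun_attained[OF D] by blast
    then show "x \<in> fst ` (convex hull D \<inter> {z. snd (snd z) \<le> t})" by force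
  next
    fix x assume "x \<in> fst ` (convex hull D \<inter> {z. snd (snd z) \<le> t})"
    then obtain u c where "(x, u, c) \<in> convex hull D" "c \<le> t" by force
    then show "x \<in> {x \<in> safe_set D. Q_fun D x \<le> t}"
      using Q_fun_le[OF D] unfolding safe_set_eq_fst_convex_hull by force
  qed
  moreover have "closed {z::(real^'n) \<times> (real^'u) \<times> real. snd (snd z) \<le> t}"
    by (intro closed_Collect_le continuous_intros)
  then have "compact (convex hull D \<inter> {z. snd (snd z) \<le> t})"
    using D by (intro compact_Int_closed finite_imp_compact_convex_hull)
  ultimately show ?thesis
    by (simp add: compact_continuous_image continuous_on_fst)
qed

text \<open>The indicator replaces the unspecified values off the safe set by 0; the complement of
  the safe set therefore joins the sublevel set exactly when \<open>0 \<le> t\<close>.\<close>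

lemma borel_measurable_Q_fun:
  fixes D :: "('n::finite, 'u::finite) column set"
  assumes D: "finite D"
  shows "(\<lambda>x. indicator (safe_set D) x * Q_fun D x) \<in> borel_measurable borel"
proof (rule borel_measurableI_le)
  fix t
  let ?L = "{x \<in> safe_set D. Q_fun D x \<le> t}"
  have "{x. indicator (safe_set D) x * Q_fun D x \<le> t} =
      ?L \<union> (if 0 \<le> t then - safe_set D else {})"
    by (auto simp: indicator_def)
  moreover have "?L \<in> sets borel"
    using compact_Q_fun_sublevel[OF D] by (intro borel_closed compact_imp_closed)
  moreover have "safe_set D \<in> sets borel"
    using compact_safe_set[OF D] by (intro borel_closed compact_imp_closed)
  ultimately show "{x \<in> space borel. indicator (safe_set D) x * Q_fun D x \<le> t} \<in> sets borel"
    by auto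
qed

section \<open>Stored data of the MPC scheme\<close>

lemma convex_pontryagin_diff:
  assumes "convex S"
  shows "convex (S \<ominus> Y)"
proof (rule convexI)
  fix x y u v assume x: "x \<in> S \<ominus> Y" and y: "y \<in> S \<ominus> Y" and uv: "0 \<le> u" "0 \<le> v" "u + v = (1::real)"
  have "u *\<^sub>R x + v *\<^sub>R y + z \<in> S" if "z \<in> Y" for z
  proof -
    have "u *\<^sub>R (x + z) + v *\<^sub>R (y + z) \<in> S"
      using x y that uv by (intro convexD[OF assms]) (auto simp: pontryagin_diff_def)
    moreover have "u *\<^sub>R (x + z) + v *\<^sub>R (y + z) = u *\<^sub>R x + v *\<^sub>R y + (u + v) *\<^sub>R z"
      by (simp add: algebra_simps)
    ultimately show ?thesis using uv by simp
  qed
  moreover have "u *\<^sub>R x + v *\<^sub>R y \<in> S"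
    using x y uv by (intro convexD[OF assms]) (auto simp: pontryagin_diff_def)
  ultimately show "u *\<^sub>R x + v *\<^sub>R y \<in> S \<ominus> Y" by (simp add: pontryagin_diff_def)
qed

lemma pontryagin_diff_mono: "S \<subseteq> S' \<Longrightarrow> S \<ominus> Y \<subseteq> S' \<ominus> Y"
  by (auto simp: pontryagin_diff_def)

text \<open>A convex combination of columns of equal cost \<open>c\<close> again has cost
  \<open>c\<close>, whatever the inputs are. This serves the target set with cost 0 and each tube
  section with its own cost.\<close>

lemma convex_hull_same_cost:
  fixes D :: "('n::finite, 'u::finite) column set"
  assumes V: "\<And>v. v \<in> V \<Longrightarrow> \<exists>u. (v, u, c) \<in> D" and x: "x \<in> convex hull V"
  shows "\<exists>u. (x, u, c) \<in> convex hull D"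
proof -
  let ?S = "{x. \<exists>u. (x, u, c) \<in> convex hull D}"
  have "convex ?S"
  proof (rule convexI)
    fix x y and s t :: real assume "x \<in> ?S" "y \<in> ?S" and st: "0 \<le> s" "0 \<le> t" "s + t = 1"
    then obtain u v where "(x, u, c) \<in> convex hull D" "(y, v, c) \<in> convex hull D" by blast
    then have "s *\<^sub>R (x, u, c) + t *\<^sub>R (y, v, c) \<in> convex hull D"
      using st by (intro convexD convex_convex_hull)
    moreover have "s * c + t * c = c" using st by (metis distrib_right mult_1)
    ultimately show "s *\<^sub>R x + t *\<^sub>R y \<in> ?S" by auto
  qed
  moreover have "V \<subseteq> ?S" using V by (blast intro: hull_inc)
  ultimately have "convex hull V \<subseteq> ?S" by (intro hull_minimal)
  with x show ?thesis by auto
qed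

locale mpc_problem =
  fixes A :: "real^'n^'n" and B :: "real^'u^'n"
    and X W G :: "(real^'n) set" and U :: "(real^'u) set"
    and l :: "real^'n \<Rightarrow> real^'u \<Rightarrow> real"
    and M :: nat and pm :: "nat \<Rightarrow> real" and wt :: "nat \<Rightarrow> real^'n"
  assumes convex_X: "convex X" and convex_U: "convex U"
    and G_subset: "G \<subseteq> X" and G_hull: "G = convex hull (vertices G)" and convex_G: "convex G"
    and wt_W: "\<And>m. m < M \<Longrightarrow> wt m \<in> W"
    and l_convex: "convex_on (X \<times> U) (\<lambda>(x, u). l x u)"
    and pm_nonneg: "\<And>m. m < M \<Longrightarrow> 0 \<le> pm m" and pm_sum: "(\<Sum>m<M. pm m) = 1"
begin

abbreviation "inputs \<equiv> mpc_inputs A B X U W"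
abbreviation "objective \<equiv> mpc_objective A B l M pm wt"

text \<open>As \<open>inputs D\<close> refers to the safe set of \<open>D\<close> itself, this is a
  self-referential condition: each stored input leads back into the hull of the stored states under
  every disturbance.\<close>

definition feasible_data :: "('n, 'u) column set \<Rightarrow> bool" where
  "feasible_data D \<longleftrightarrow> finite D \<and> (\<forall>(x, u, c)\<in>D. u \<in> inputs D x)"

text \<open>The conditions on zero costs make the target set the zero set of \<open>Q_fun D\<close>.\<close>

definition costed_data :: "('n, 'u) column set \<Rightarrow> bool" where
  "costed_data D \<longleftrightarrow>
     (\<forall>(x, u, c)\<in>D. objective D x u \<le> c \<and> 0 \<le> c \<and> (c = 0 \<longrightarrow> x \<in> G)) \<and>
     (\<forall>v\<in>vertices G. \<exists>u. (v, u, 0) \<in> D)"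

lemma finite_feasible_data: "feasible_data D \<Longrightarrow> finite D"
  by (simp add: feasible_data_def)

lemma inputsD:
  assumes "u \<in> inputs D x"
  shows "x \<in> X" "u \<in> U" "A *v x + B *v u \<in> safe_set D"
    "v \<in> W \<Longrightarrow> A *v x + B *v u + v \<in> safe_set D"
  using assms by (auto simp: mpc_inputs_def pontryagin_diff_def)

lemma inputs_convex:
  assumes "u1 \<in> inputs D x1" "u2 \<in> inputs D x2" "0 \<le> s" "0 \<le> t" "s + t = 1"
  shows "s *\<^sub>R u1 + t *\<^sub>R u2 \<in> inputs D (s *\<^sub>R x1 + t *\<^sub>R x2)"
proof -
  have "s *\<^sub>R (A *v x1 + B *v u1) + t *\<^sub>R (A *v x2 + B *v u2) \<in> safe_set D \<ominus> W"
    using assms convex_pontryagin_diff[OF convex_safe_set]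
    by (intro convexD) (auto simp: mpc_inputs_def)
  moreover have "s *\<^sub>R (A *v x1 + B *v u1) + t *\<^sub>R (A *v x2 + B *v u2) =
      A *v (s *\<^sub>R x1 + t *\<^sub>R x2) + B *v (s *\<^sub>R u1 + t *\<^sub>R u2)"
    by (simp add: matrix_vector_right_distrib matrix_vector_mult_scaleR algebra_simps)
  ultimately show ?thesis
    using assms convex_X convex_U by (auto simp: mpc_inputs_def intro: convexD)
qed

lemma inputs_mono: "D \<subseteq> D' \<Longrightarrow> inputs D x \<subseteq> inputs D' x"
  using pontryagin_diff_mono[OF safe_set_mono, of D D' W] by (auto simp: mpc_inputs_def)

lemma objective_convex:
  assumes D: "finite D" and u: "u1 \<in> inputs D x1" "u2 \<in> inputs D x2"
    and st: "0 \<le> s" "0 \<le> t" "s + t = 1"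
  shows "objective D (s *\<^sub>R x1 + t *\<^sub>R x2) (s *\<^sub>R u1 + t *\<^sub>R u2)
    \<le> s * objective D x1 u1 + t * objective D x2 u2"
proof -
  have s: "s = 1 - t" using st by simp
  have l_le: "l (s *\<^sub>R x1 + t *\<^sub>R x2) (s *\<^sub>R u1 + t *\<^sub>R u2) \<le> s * l x1 u1 + t * l x2 u2"
    using convex_onD[OF l_convex, of t "(x1, u1)" "(x2, u2)"] inputsD[OF u(1)] inputsD[OF u(2)] st
    by (simp add: s)
  have "Q_fun D (A *v (s *\<^sub>R x1 + t *\<^sub>R x2) + B *v (s *\<^sub>R u1 + t *\<^sub>R u2) + wt m)
      \<le> s * Q_fun D (A *v x1 + B *v u1 + wt m) + t * Q_fun D (A *v x2 + B *v u2 + wt m)"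
    if m: "m < M" for m
  proof -
    have "Q_fun D (s *\<^sub>R (A *v x1 + B *v u1 + wt m) + t *\<^sub>R (A *v x2 + B *v u2 + wt m))
      \<le> s * Q_fun D (A *v x1 + B *v u1 + wt m) + t * Q_fun D (A *v x2 + B *v u2 + wt m)"
      using convex_onD[OF convex_on_Q_fun[OF D]] inputsD(4)[OF u(1)] inputsD(4)[OF u(2)] wt_W[OF m] st
      by (simp add: s)
    moreover have "s *\<^sub>R (A *v x1 + B *v u1 + wt m) + t *\<^sub>R (A *v x2 + B *v u2 + wt m) =
        A *v (s *\<^sub>R x1 + t *\<^sub>R x2) + B *v (s *\<^sub>R u1 + t *\<^sub>R u2) + wt m"
      by (simp add: s matrix_vector_right_distrib matrix_vector_mult_scaleR algebra_simps)
    ultimately show ?thesis by simp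
  qed
  then have le: "(\<Sum>m<M. pm m * Q_fun D (A *v (s *\<^sub>R x1 + t *\<^sub>R x2) + B *v (s *\<^sub>R u1 + t *\<^sub>R u2) + wt m))
      \<le> (\<Sum>m<M. pm m * (s * Q_fun D (A *v x1 + B *v u1 + wt m) + t * Q_fun D (A *v x2 + B *v u2 + wt m)))"
    using pm_nonneg by (intro sum_mono mult_left_mono) auto
  have "(\<Sum>m<M. pm m * (s * Q_fun D (A *v x1 + B *v u1 + wt m) + t * Q_fun D (A *v x2 + B *v u2 + wt m)))
      = s * (\<Sum>m<M. pm m * Q_fun D (A *v x1 + B *v u1 + wt m))
      + t * (\<Sum>m<M. pm m * Q_fun D (A *v x2 + B *v u2 + wt m))"
    by (simp add: sum_distrib_left sum.distrib algebra_simps)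
  with l_le le show ?thesis by (simp add: mpc_objective_def algebra_simps)
qed

text \<open>Feasibility is a jointly convex condition on state and input, so it passes from the
  columns to their hull. Interpolated inputs thus keep interpolated states in the safe set.\<close>

lemma feasible_data_hull:
  assumes D: "feasible_data D" and z: "(x, u, c) \<in> convex hull D"
  shows "u \<in> inputs D x"
proof -
  have "convex {(x, u, c :: real). u \<in> inputs D x}"
    by (rule convexI) (auto intro: inputs_convex)
  moreover have "D \<subseteq> {(x, u, c). u \<in> inputs D x}" using D by (auto simp: feasible_data_def)
  ultimately have "convex hull D \<subseteq> {(x, u, c). u \<in> inputs D x}" by (intro hull_minimal)
  with z show ?thesis by auto
qed

text \<open>The hull stays inside the epigraph of the jointly convex objective. Feasibility is part
  of \<open>?C\<close> because convexity of the objective is known only for feasible pairs, whose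
  successors lie where \<open>Q_fun\<close> is convex.\<close>

lemma costed_data_hull:
  assumes D: "feasible_data D" "costed_data D" and z: "(x, u, c) \<in> convex hull D"
  shows "objective D x u \<le> c"
proof -
  let ?C = "{(x, u, c). u \<in> inputs D x \<and> objective D x u \<le> c}"
  have "convex ?C"
  proof (rule convexI)
    fix y z :: "(real^'n) \<times> (real^'u) \<times> real" and s t :: real
    assume yz: "y \<in> ?C" "z \<in> ?C" and st: "0 \<le> s" "0 \<le> t" "s + t = 1"
    obtain x1 u1 c1 where y: "y = (x1, u1, c1)" by (cases y)
    obtain x2 u2 c2 where z: "z = (x2, u2, c2)" by (cases z)
    have u: "u1 \<in> inputs D x1" "u2 \<in> inputs D x2" and c: "objective D x1 u1 \<le> c1" "objective D x2 u2 \<le> c2"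
      using yz by (auto simp: y z)
    note objective_convex[OF finite_feasible_data[OF D(1)] u st]
    also have "s * objective D x1 u1 + t * objective D x2 u2 \<le> s * c1 + t * c2"
      using c st by (intro add_mono mult_left_mono) auto
    finally show "s *\<^sub>R y + t *\<^sub>R z \<in> ?C" using inputs_convex[OF u st] by (simp add: y z)
  qed
  moreover have "D \<subseteq> ?C" using D by (auto simp: feasible_data_def costed_data_def)
  ultimately have "convex hull D \<subseteq> ?C" by (intro hull_minimal)
  with z show ?thesis by auto
qed

lemma safe_set_subset:
  assumes "feasible_data D"
  shows "safe_set D \<subseteq> X"
proof
  fix x assume "x \<in> safe_set D"
  then obtain u c where "(x, u, c) \<in> convex hull D" by (auto simp: safe_set_eq_fst_convex_hull)
  from inputsD(1)[OF feasible_data_hull[OF assms this]] show "x \<in> X" .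
qed

lemma inputs_nonempty:
  assumes D: "feasible_data D" and x: "x \<in> safe_set D"
  shows "inputs D x \<noteq> {}"
proof -
  obtain u c where "(x, u, c) \<in> convex hull D" using x by (auto simp: safe_set_eq_fst_convex_hull)
  from feasible_data_hull[OF D this] show ?thesis by blast
qed

text \<open>A combination of nonnegative costs is zero only if every point of positive weight has
  cost zero; those points lie in the convex set \<open>G\<close>, hence so does their
  combination.\<close>

lemma costed_data_hull_nonneg:
  assumes D: "costed_data D" and z: "(x, u, c) \<in> convex hull D"
  shows "0 \<le> c" "c = 0 \<Longrightarrow> x \<in> G"
proof -
  let ?C = "{(x, u :: real^'u, c :: real). 0 \<le> c \<and> (c = 0 \<longrightarrow> x \<in> G)}"
  have "convex ?C"
  proof (rule convexI)
    fix y z :: "(real^'n) \<times> (real^'u) \<times> real" and s t :: real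
    assume yz: "y \<in> ?C" "z \<in> ?C" and st: "0 \<le> s" "0 \<le> t" "s + t = 1"
    obtain x1 u1 c1 where y: "y = (x1, u1, c1)" by (cases y)
    obtain x2 u2 c2 where z: "z = (x2, u2, c2)" by (cases z)
    have c: "0 \<le> s * c1" "0 \<le> t * c2" using yz st by (auto simp: y z)
    have "s *\<^sub>R x1 + t *\<^sub>R x2 \<in> G" if "s * c1 + t * c2 = 0"
    proof -
      have "s = 0 \<or> c1 = 0" "t = 0 \<or> c2 = 0" using that c by (auto simp: add_nonneg_eq_0_iff)
      then show ?thesis
        using yz st convexD[OF convex_G, of x1 x2 s t] by (auto simp: y z)
    qed
    then show "s *\<^sub>R y + t *\<^sub>R z \<in> ?C" using c by (simp add: y z)
  qed
  moreover have "D \<subseteq> ?C" using D by (auto simp: costed_data_def)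
  ultimately have "convex hull D \<subseteq> ?C" by (intro hull_minimal)
  with z show "0 \<le> c" "c = 0 \<Longrightarrow> x \<in> G" by auto
qed

lemma Q_fun_nonneg:
  assumes "finite D" "costed_data D" "x \<in> safe_set D"
  shows "0 \<le> Q_fun D x"
proof -
  obtain u where "(x, u, Q_fun D x) \<in> convex hull D" using Q_fun_attained[OF assms(1,3)] .
  from costed_data_hull_nonneg(1)[OF assms(2) this] show ?thesis .
qed

lemma Q_fun_eq_0_imp_target:
  assumes "finite D" "costed_data D" "x \<in> safe_set D" "Q_fun D x = 0"
  shows "x \<in> G"
proof -
  obtain u where "(x, u, Q_fun D x) \<in> convex hull D" using Q_fun_attained[OF assms(1,3)] .
  from costed_data_hull_nonneg(2)[OF assms(2) this assms(4)] show ?thesis .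
qed

lemma target_hull:
  assumes D: "costed_data D" and x: "x \<in> G"
  obtains u where "(x, u, 0) \<in> convex hull D"
proof -
  have "x \<in> convex hull (vertices G)" using x G_hull by simp
  then have "\<exists>u. (x, u, 0) \<in> convex hull D"
    using D by (intro convex_hull_same_cost) (auto simp: costed_data_def)
  then show ?thesis using that by blast
qed

text \<open>The input interpolated at the lowest point of the hull over \<open>x\<close> competes
  with \<open>us\<close>: it is feasible, and its objective is at most its cost
  \<open>Q_fun D x\<close>. This is the Lyapunov inequality before any expectation is taken.\<close>

lemma objective_optimal_le_Q_fun:
  assumes D: "feasible_data D" "costed_data D" and x: "x \<in> safe_set D"
    and opt: "is_arg_min (objective D x) (\<lambda>u. u \<in> inputs D x) us"
  shows "objective D x us \<le> Q_fun D x"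
proof -
  obtain u where u: "(x, u, Q_fun D x) \<in> convex hull D"
    using Q_fun_attained[OF finite_feasible_data[OF D(1)] x] .
  have "objective D x us \<le> objective D x u"
    using opt feasible_data_hull[OF D(1) u] by (auto simp: is_arg_min_def not_less)
  with costed_data_hull[OF D u] show ?thesis by simp
qed

lemma mpc_value_eq:
  assumes "is_arg_min (objective D x) (\<lambda>u. u \<in> inputs D x) us"
  shows "mpc_value A B l X U W M pm wt D x = objective D x us"
  unfolding mpc_value_def
  by (rule cInf_eq_minimum) (use assms in \<open>auto simp: is_arg_min_def not_less\<close>)

section \<open>Enlarging the data after an episode\<close>

lemma feasible_data_update:
  assumes D: "feasible_data D" and V: "finite V" "\<And>x. x \<in> V \<Longrightarrow> us x \<in> inputs D x"
  shows "feasible_data (D \<union> (\<lambda>x. (x, us x, c x)) ` V)" (is "feasible_data ?D")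
proof -
  have mono: "inputs D x \<subseteq> inputs ?D x" for x by (rule inputs_mono) simp
  have "u \<in> inputs ?D x" if z: "(x, u, a) \<in> ?D" for x u a
  proof -
    have "u \<in> inputs D x" using z D V(2) by (auto simp: feasible_data_def)
    with mono show ?thesis by blast
  qed
  then show ?thesis using finite_feasible_data[OF D] V(1) by (auto simp: feasible_data_def)
qed

lemma objective_antimono:
  assumes D': "finite D'" "D \<subseteq> D'" and u: "u \<in> inputs D x"
  shows "objective D' x u \<le> objective D x u"
  unfolding mpc_objective_def
  using inputsD(4)[OF u] wt_W pm_nonneg by (intro add_left_mono sum_mono mult_left_mono Q_fun_antimono D') auto

lemma stage_cost_le_objective:
  assumes D: "feasible_data D" "costed_data D" and u: "u \<in> inputs D x"
  shows "l x u \<le> objective D x u"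
  unfolding mpc_objective_def
  using Q_fun_nonneg[OF finite_feasible_data[OF D(1)] D(2)] inputsD(4)[OF u] wt_W pm_nonneg
  by (intro le_add_same_cancel1[THEN iffD2] sum_nonneg mult_nonneg_nonneg) auto

text \<open>More columns enlarge the safe set and lower \<open>Q_fun\<close>, hence the objective.
  Old cost entries therefore still dominate, and a new entry dominates since it equals the objective
  for the old data. It also dominates the stage cost, so it can vanish only at states in
  \<open>G\<close>.\<close>

lemma costed_data_update:
  assumes D: "feasible_data D" "costed_data D"
    and V: "finite V" "\<And>x. x \<in> V \<Longrightarrow> us x \<in> inputs D x" "\<And>x. x \<in> V \<Longrightarrow> c x = objective D x (us x)"
    and l: "\<And>x u. x \<in> X \<Longrightarrow> u \<in> U \<Longrightarrow> 0 \<le> l x u" "\<And>x u. x \<in> X - G \<Longrightarrow> u \<in> U \<Longrightarrow> 0 < l x u"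
  shows "costed_data (D \<union> (\<lambda>x. (x, us x, c x)) ` V)" (is "costed_data ?D")
proof -
  have fin: "finite ?D" using D(1) V(1) by (simp add: finite_feasible_data)
  have mono: "objective ?D x u \<le> objective D x u" if "u \<in> inputs D x" for x u
    using that by (intro objective_antimono[OF fin]) auto
  have old: "objective ?D x u \<le> a \<and> 0 \<le> a \<and> (a = 0 \<longrightarrow> x \<in> G)" if z: "(x, u, a) \<in> D" for x u a
  proof -
    have "u \<in> inputs D x" using z D(1) by (auto simp: feasible_data_def)
    moreover have "objective D x u \<le> a \<and> 0 \<le> a \<and> (a = 0 \<longrightarrow> x \<in> G)"
      using z D(2) by (auto simp: costed_data_def)
    ultimately show ?thesis using mono by (meson order_trans)
  qed
  have new: "objective ?D x (us x) \<le> c x \<and> 0 \<le> c x \<and> (c x = 0 \<longrightarrow> x \<in> G)" if x: "x \<in> V" for x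
  proof -
    note us = V(2)[OF x] and xu = inputsD(1,2)[OF V(2)[OF x]]
    have "l x (us x) \<le> c x" using stage_cost_le_objective[OF D us] V(3)[OF x] by simp
    moreover have "x \<in> G \<or> 0 < l x (us x)" using l(2)[of x "us x"] xu by blast
    ultimately show ?thesis using mono[OF us] V(3)[OF x] l(1)[OF xu] by auto
  qed
  have "objective ?D x u \<le> a \<and> 0 \<le> a \<and> (a = 0 \<longrightarrow> x \<in> G)" if z: "(x, u, a) \<in> ?D" for x u a
    using z old[of x u a] new[of x] by auto
  then show ?thesis using D(2) unfolding costed_data_def by auto
qed

lemma closed_loop_safe:
  assumes D: "feasible_data D" and us: "\<And>x. inputs D x \<noteq> {} \<Longrightarrow> us x \<in> inputs D x"
    and x0: "x0 \<in> safe_set D" and w: "\<And>i. i < k \<Longrightarrow> w i \<in> W"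
  shows "closed_loop A B us x0 w k \<in> safe_set D"
  using w
proof (induction k)
  case (Suc k)
  then have "closed_loop A B us x0 w k \<in> safe_set D" by simp
  from inputsD(4)[OF us[OF inputs_nonempty[OF D this]]] Suc.prems[of k] show ?case by simp
qed (simp add: x0)

text \<open>For nonzero multipliers the explored state may lie outside the safe set; the exploration
  problem itself then supplies a feasible input, its second-stage input \<open>uW v\<close>.
  Otherwise the state is drawn from the safe set.\<close>

lemma explored_feasible:
  fixes Hu :: "real^'u^'c"
  assumes D: "feasible_data D" and e: "explored A B l X U Hu hu W M pm wt D x us xW"
    and v: "v \<in> vertices W"
  shows "inputs D (xW v) \<noteq> {}"
proof -
  have vW: "v \<in> W" using v by (simp add: vertices_def extreme_point_of_def)
  show ?thesis
    using e unfolding explored_def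
  proof (elim exE conjE)
    fix r :: nat and H :: "nat \<Rightarrow> real^'n" and h \<nu> :: "nat \<Rightarrow> real" and g :: "real^'u" and \<gamma> :: "real^'c"
    assume e: "if \<exists>i<r. \<nu> i \<noteq> 0
         then \<exists>d uW.
                is_arg_max (\<lambda>(d, uW). \<Sum>i<r. \<nu> i * (H i \<bullet> (B *v d)))
                  (\<lambda>s. s \<in> exploration_feasible A B X U W D g x us) (d, uW) \<and>
                (\<forall>v\<in>vertices W. xW v = A *v x + B *v (us + d) + v)
         else \<forall>v\<in>vertices W. xW v \<in> safe_set D"
    show ?thesis
    proof (cases "\<exists>i<r. \<nu> i \<noteq> 0")
      case True
      from e[unfolded if_P[OF True]] obtain d uW
        where d: "(d, uW) \<in> exploration_feasible A B X U W D g x us"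
          and xW: "xW v = A *v x + B *v (us + d) + v"
        unfolding is_arg_max_def using v by blast
      have "uW v \<in> inputs D (xW v)"
        using d v vW unfolding xW exploration_feasible_def mpc_inputs_def pontryagin_diff_def by auto
      then show ?thesis by blast
    next
      case False
      from e[unfolded if_not_P[OF False]] v show ?thesis by (intro inputs_nonempty[OF D]) blast
    qed
  qed
qed

end

section \<open>Initial data of the tube controller and expected value after one step\<close>

context mpc_problem begin

lemma objective_le:
  assumes "\<And>m. m < M \<Longrightarrow> Q_fun D (A *v x + B *v u + wt m) \<le> c"
  shows "objective D x u \<le> l x u + c"
proof -
  have "(\<Sum>m<M. pm m * Q_fun D (A *v x + B *v u + wt m)) \<le> (\<Sum>m<M. pm m * c)"
    using assms pm_nonneg by (intro sum_mono mult_left_mono) auto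
  also have "\<dots> = c" using pm_sum by (simp add: sum_distrib_right[symmetric])
  finally show ?thesis by (simp add: mpc_objective_def)
qed

lemma Q_fun_target:
  assumes D: "finite D" "costed_data D" and x: "x \<in> G"
  shows "Q_fun D x = 0" "x \<in> safe_set D"
proof -
  obtain u where u: "(x, u, 0) \<in> convex hull D" using target_hull[OF D(2) x] .
  then show safe: "x \<in> safe_set D" by (force simp: safe_set_eq_fst_convex_hull)
  show "Q_fun D x = 0"
    using Q_fun_le[OF D(1) u] Q_fun_nonneg[OF D safe] by simp
qed

text \<open>Each tube section is steered into the next one, the last section lies in
  \<open>G\<close>, and \<open>\<kappa>\<close> keeps \<open>G\<close> invariant; along this chain
  the costs \<open>J\<close> fall by at least the stage cost. The cost claim has separate premises
  so that the first two claims are available without a sign condition on the stage cost.\<close>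

lemma initial_data:
  fixes E :: "nat \<Rightarrow> (real^'n) set" and tube :: "nat \<Rightarrow> real^'n \<Rightarrow> real^'u" and \<kappa> :: "real^'n \<Rightarrow> real^'u"
    and J :: "nat \<Rightarrow> real" and N :: nat
  defines "D \<equiv> (\<lambda>v. (v, \<kappa> v, 0)) ` (vertices G \<union> vertices (E (Suc N))) \<union>
      (\<Union>k\<le>N. (\<lambda>v. (v, tube k v, J k)) ` vertices (E k))"
  assumes zero_W: "0 \<in> W"
    and G: "finite (vertices G)" "\<And>x. x \<in> G \<Longrightarrow> \<kappa> x \<in> U"
      "\<And>x v. x \<in> G \<Longrightarrow> v \<in> W \<Longrightarrow> A *v x + B *v \<kappa> x + v \<in> G"
    and E: "\<And>k. finite (vertices (E k))" "\<And>k. E k = convex hull (vertices (E k))"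
      "\<And>k. k \<le> N \<Longrightarrow> E k \<subseteq> X" "E (Suc N) \<subseteq> G"
    and tube: "\<And>k x. k \<le> N \<Longrightarrow> x \<in> E k \<Longrightarrow> tube k x \<in> U"
      "\<And>k x v. k \<le> N \<Longrightarrow> x \<in> E k \<Longrightarrow> v \<in> W \<Longrightarrow> A *v x + B *v tube k x + v \<in> E (Suc k)"
    and J_end: "J (Suc N) = 0"
  shows "feasible_data D" "E 0 \<subseteq> safe_set D"
    and "(\<And>x. x \<in> G \<Longrightarrow> l x (\<kappa> x) = 0) \<Longrightarrow>
      (\<And>x u. x \<in> X \<Longrightarrow> u \<in> U \<Longrightarrow> 0 \<le> l x u) \<Longrightarrow>
      (\<And>x u. x \<in> X - G \<Longrightarrow> u \<in> U \<Longrightarrow> 0 < l x u) \<Longrightarrow>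
      (\<And>k x. k \<le> N \<Longrightarrow> x \<in> E k \<Longrightarrow> l x (tube k x) + J (Suc k) \<le> J k) \<Longrightarrow> costed_data D"
proof -
  have vertices_subset: "vertices S \<subseteq> S" for S :: "(real^'n) set"
    by (auto simp: vertices_def extreme_point_of_def)
  have fin: "finite D" using G E by (auto simp: D_def)
  have tube_hull: "\<exists>u. (x, u, J k) \<in> convex hull D" if k: "k \<le> Suc N" and x: "x \<in> E k" for k x
  proof (rule convex_hull_same_cost[of "vertices (E k)"])
    show "x \<in> convex hull (vertices (E k))" using x E(2) by blast
    fix v assume "v \<in> vertices (E k)"
    \<comment> \<open>The final section is stored with the literal cost 0, which is
      \<open>J (Suc N)\<close>.\<close>
    with k J_end show "\<exists>u. (v, u, J k) \<in> D"
      by (cases "k = Suc N") (fastforce simp: D_def)+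
  qed
  have G_hull': "\<exists>u. (x, u, 0) \<in> convex hull D" if x: "x \<in> G" for x
    using x G_hull by (intro convex_hull_same_cost[of "vertices G"]) (auto simp: D_def)
  have E_safe: "E k \<subseteq> safe_set D" if "k \<le> Suc N" for k
    using tube_hull[OF that] by (force simp: safe_set_eq_fst_convex_hull)
  then show "E 0 \<subseteq> safe_set D" by simp
  have G_safe: "G \<subseteq> safe_set D"
    using G_hull' by (force simp: safe_set_eq_fst_convex_hull)
  \<comment> \<open>The definition of \<open>\<ominus>\<close> also asks for the undisturbed
    successor to be in the set; this is the case of the disturbance 0.\<close>
  have inputs_G: "\<kappa> x \<in> inputs D x" if x: "x \<in> G" for x
    using G(2)[OF x] G(3)[OF x] G_safe G_subset x G(3)[OF x zero_W]
    by (auto simp: mpc_inputs_def pontryagin_diff_def)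
  have inputs_tube: "tube k x \<in> inputs D x" if k: "k \<le> N" and x: "x \<in> E k" for k x
    using tube(1)[OF k x] tube(2)[OF k x] E_safe[of "Suc k"] E(3)[OF k] x k tube(2)[OF k x zero_W]
    by (auto simp: mpc_inputs_def pontryagin_diff_def)
  have D_cases: "(x \<in> G \<and> u = \<kappa> x \<and> a = 0) \<or> (\<exists>k\<le>N. x \<in> E k \<and> u = tube k x \<and> a = J k)"
    if "(x, u, a) \<in> D" for x u a
    using that vertices_subset[of G] vertices_subset[of "E _"] E(4) unfolding D_def by blast
  have "u \<in> inputs D x" if "(x, u, a) \<in> D" for x u a
    using D_cases[OF that] inputs_G inputs_tube by auto
  with fin show "feasible_data D" by (auto simp: feasible_data_def)
  assume l: "\<And>x. x \<in> G \<Longrightarrow> l x (\<kappa> x) = 0" "\<And>x u. x \<in> X \<Longrightarrow> u \<in> U \<Longrightarrow> 0 \<le> l x u"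
    "\<And>x u. x \<in> X - G \<Longrightarrow> u \<in> U \<Longrightarrow> 0 < l x u"
    and J: "\<And>k x. k \<le> N \<Longrightarrow> x \<in> E k \<Longrightarrow> l x (tube k x) + J (Suc k) \<le> J k"
  \<comment> \<open>Backward induction from the last section. The bound on \<open>J k\<close> is
    available only at a point of \<open>E k\<close>, so nonemptiness is carried along: the
    disturbance 0 moves a point of \<open>E k\<close> into \<open>E (Suc k)\<close>.\<close>
  have J_nonneg: "0 \<le> J k" if "k \<le> Suc N" "x \<in> E k" for k x
  proof -
    have "\<forall>x\<in>E k. 0 \<le> J k" if "k \<le> Suc N" for k
      using that
    proof (induction k rule: inc_induct)
      case base
      then show ?case by (simp add: J_end)
    next
      case (step k)
      have "0 \<le> J k" if x: "x \<in> E k" for x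
      proof -
        have k: "k \<le> N" using step by simp
        have "0 \<le> J (Suc k)" using step.IH tube(2)[OF k x zero_W] by blast
        moreover have "0 \<le> l x (tube k x)" using l(2) E(3)[OF k] tube(1)[OF k x] x by blast
        ultimately show ?thesis using J[OF k x] by simp
      qed
      then show ?case by blast
    qed
    with that show ?thesis by blast
  qed
  have "objective D x u \<le> a \<and> 0 \<le> a \<and> (a = 0 \<longrightarrow> x \<in> G)" if z: "(x, u, a) \<in> D" for x u a
    using D_cases[OF z]
  proof (elim disjE conjE exE)
    assume x: "x \<in> G" and u: "u = \<kappa> x" and a: "a = 0"
    have "Q_fun D (A *v x + B *v \<kappa> x + wt m) \<le> 0" if "m < M" for m
      using G_hull'[OF G(3)[OF x wt_W[OF that]]] Q_fun_le[OF fin] by blast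
    from objective_le[OF this] show ?thesis using l(1)[OF x] x by (simp add: u a)
  next
    fix k assume k: "k \<le> N" and x: "x \<in> E k" and u: "u = tube k x" and a: "a = J k"
    have "Q_fun D (A *v x + B *v tube k x + wt m) \<le> J (Suc k)" if "m < M" for m
      using tube_hull[OF _ tube(2)[OF k x wt_W[OF that]]] Q_fun_le[OF fin] k by (metis Suc_le_mono)
    note obj = objective_le[OF this]
    have xX: "x \<in> X" using E(3)[OF k] x by blast
    have y: "A *v x + B *v tube k x + 0 \<in> E (Suc k)" by (rule tube(2)[OF k x zero_W])
    have "0 \<le> J (Suc k)"
      using J_nonneg[OF _ y] k by simp
    moreover have "x \<in> G \<or> 0 < l x (tube k x)" using l(3) xX tube(1)[OF k x] by blast
    ultimately show ?thesis
      using obj J[OF k x] l(2)[OF xX tube(1)[OF k x]] by (auto simp: u a)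
  qed
  moreover have "\<forall>v\<in>vertices G. \<exists>u. (v, u, 0) \<in> D" by (auto simp: D_def)
  ultimately show "costed_data D" by (auto simp: costed_data_def)
qed

text \<open>Jensen's inequality for the weights: \<open>y + v\<close> is the combination of the
  points \<open>y + wt m\<close> with weights \<open>\<mu> v m\<close>, and integrating these
  weights over \<open>v\<close> gives \<open>pm m\<close>. Hence the discretized sum in the
  objective bounds the true expectation.\<close>

lemma expected_Q_fun_le:
  fixes p :: "(real^'n) measure"
  assumes D: "feasible_data D" and p: "prob_space p" "sets p = sets borel" "AE v in p. v \<in> W"
    and \<mu>: "\<And>v m. v \<in> W \<Longrightarrow> m < M \<Longrightarrow> 0 \<le> \<mu> v m" "\<And>v. v \<in> W \<Longrightarrow> (\<Sum>m<M. \<mu> v m) = 1"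
      "\<And>v. v \<in> W \<Longrightarrow> v = (\<Sum>m<M. \<mu> v m *\<^sub>R wt m)"
    and pm: "\<And>m. m < M \<Longrightarrow> set_integrable p W (\<lambda>v. \<mu> v m)"
      "\<And>m. m < M \<Longrightarrow> pm m = (LINT v:W|p. \<mu> v m)"
    and C: "\<And>x. \<bar>indicator (safe_set D) x * Q_fun D x\<bar> \<le> C"
    and y: "y \<in> safe_set D \<ominus> W"
  shows "(LINT v|p. indicator (safe_set D) (y + v) * Q_fun D (y + v))
    \<le> (\<Sum>m<M. pm m * Q_fun D (y + wt m))"
proof -
  interpret prob_space p by fact
  note [measurable_cong] = p(2)
  have [measurable]: "(\<lambda>x. indicator (safe_set D) x * Q_fun D x) \<in> borel_measurable borel"
    by (rule borel_measurable_Q_fun[OF finite_feasible_data[OF D]])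
  have safe: "y + v \<in> safe_set D" if "v \<in> W" for v using y that by (auto simp: pontryagin_diff_def)
  have meas: "(\<lambda>v. indicator (safe_set D) (y + v) * Q_fun D (y + v)) \<in> borel_measurable p"
    by (rule measurable_compose[of "\<lambda>v. y + v" p borel "\<lambda>x. indicator (safe_set D) x * Q_fun D x"]) measurable
  have int: "integrable p (\<lambda>v. (indicator W v *\<^sub>R \<mu> v m) * Q_fun D (y + wt m))" if "m < M" for m
    using pm(1)[OF that] unfolding set_integrable_def by (rule integrable_mult_left)
  have "(LINT v|p. indicator (safe_set D) (y + v) * Q_fun D (y + v))
      \<le> (LINT v|p. (\<Sum>m<M. (indicator W v *\<^sub>R \<mu> v m) * Q_fun D (y + wt m)))"
  proof (rule integral_mono_AE)
    show "integrable p (\<lambda>v. indicator (safe_set D) (y + v) * Q_fun D (y + v))"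
      by (rule integrable_const_bound[of _ C]) (use C meas in auto)
    show "integrable p (\<lambda>v. \<Sum>m<M. (indicator W v *\<^sub>R \<mu> v m) * Q_fun D (y + wt m))"
      by (intro Bochner_Integration.integrable_sum int) auto
    show "AE v in p. indicator (safe_set D) (y + v) * Q_fun D (y + v)
        \<le> (\<Sum>m<M. (indicator W v *\<^sub>R \<mu> v m) * Q_fun D (y + wt m))"
      using p(3)
    proof eventually_elim
      case (elim v)
      have M: "{..<M} \<noteq> {}" using \<mu>(2)[OF elim] by auto
      have "(\<Sum>m<M. \<mu> v m *\<^sub>R (y + wt m)) = (\<Sum>m<M. \<mu> v m) *\<^sub>R y + (\<Sum>m<M. \<mu> v m *\<^sub>R wt m)"
        by (simp add: scaleR_sum_left scaleR_add_right sum.distrib)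
      then have eq: "(\<Sum>m<M. \<mu> v m *\<^sub>R (y + wt m)) = y + v"
        using \<mu>(2,3)[OF elim] by simp
      have "Q_fun D (\<Sum>m<M. \<mu> v m *\<^sub>R (y + wt m)) \<le> (\<Sum>m<M. \<mu> v m * Q_fun D (y + wt m))"
        using \<mu>(1,2)[OF elim] safe[OF wt_W]
        by (intro convex_on_sum[OF _ M convex_on_Q_fun[OF finite_feasible_data[OF D]]]) auto
      then show ?case using elim safe[OF elim] by (simp add: eq)
    qed
  qed
  also have "\<dots> = (\<Sum>m<M. (LINT v|p. (indicator W v *\<^sub>R \<mu> v m) * Q_fun D (y + wt m)))"
    by (intro Bochner_Integration.integral_sum int) auto
  also have "\<dots> = (\<Sum>m<M. pm m * Q_fun D (y + wt m))"
    by (intro sum.cong) (simp_all add: pm(2) set_lebesgue_integral_def)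
  finally show ?thesis .
qed

lemma Q_fun_bounded:
  fixes D :: "('n, 'u) column set"
  assumes D: "finite D"
  obtains C where "\<And>x. \<bar>indicator (safe_set D) x * Q_fun D x\<bar> \<le> C"
proof -
  have "compact ((\<lambda>z. snd (snd z)) ` (convex hull D))"
    using D by (intro compact_continuous_image finite_imp_compact_convex_hull continuous_intros)
  then have "bounded ((\<lambda>z. snd (snd z)) ` (convex hull D))" by (rule compact_imp_bounded)
  then obtain C where C: "\<And>z. z \<in> convex hull D \<Longrightarrow> \<bar>snd (snd z)\<bar> \<le> C"
    unfolding bounded_iff real_norm_def by blast
  have "\<bar>indicator (safe_set D) x * Q_fun D x\<bar> \<le> max C 0" for x
  proof (cases "x \<in> safe_set D")
    case True
    then obtain u where "(x, u, Q_fun D x) \<in> convex hull D" using Q_fun_attained[OF D] by blast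
    from C[OF this] True show ?thesis by simp
  qed simp
  then show ?thesis using that by blast
qed

end

section \<open>Hitting a convex set by a system with additive noise\<close>

text \<open>The complement of the support is covered by open null sets, and by Lindelof countably
  many of them suffice.\<close>

lemma AE_in_measure_support:
  fixes p :: "'a::second_countable_topology measure"
  assumes "sets p = sets borel"
  shows "AE x in p. x \<in> measure_support p"
proof -
  let ?F = "{V. open V \<and> emeasure p V = 0}"
  obtain F where F: "F \<subseteq> ?F" "countable F" "\<Union>F = \<Union>?F"
    by (rule Lindelof[of ?F]) auto
  have "(\<Union>V\<in>F. V) \<in> null_sets p"
    using F(1,2) assms by (intro null_sets_UN') (auto simp: null_sets_def)
  moreover have "- measure_support p \<subseteq> \<Union>?F"
    by (auto simp: measure_support_def not_less)
  ultimately show ?thesis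
    using F(3) by (intro AE_I'[of "\<Union>F"]) auto
qed

text \<open>Finitely many balls of half the radius cover \<open>C\<close>, and each has positive
  measure. Every ball of full radius centred in \<open>C\<close> contains one of them, so their
  least measure is a uniform bound.\<close>

lemma uniform_ball_measure:
  fixes p :: "'a::metric_space measure"
  assumes p: "prob_space p" "sets p = sets borel"
    and C: "compact C" "C \<subseteq> measure_support p" and e: "0 < e"
  obtains \<beta> where "0 < \<beta>" "\<And>c. c \<in> C \<Longrightarrow> \<beta> \<le> measure p (ball c e)"
proof -
  interpret prob_space p by fact
  have "C \<subseteq> (\<Union>c\<in>C. ball c (e/2))" using e by auto
  then obtain C' where C': "C' \<subseteq> C" "finite C'" "C \<subseteq> (\<Union>c\<in>C'. ball c (e/2))"
    using compactE_image[OF C(1), of C "\<lambda>c. ball c (e/2)"] by (metis open_ball)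
  \<comment> \<open>The inserted 1 keeps the minimum defined when \<open>C'\<close> is
    empty.\<close>
  define \<beta> where "\<beta> = Min (insert 1 ((\<lambda>c. measure p (ball c (e/2))) ` C'))"
  have pos: "0 < measure p (ball c (e/2))" if "c \<in> C'" for c
  proof -
    have "0 < emeasure p (ball c (e/2))"
      using that C' C e by (auto simp: measure_support_def)
    then show ?thesis by (simp add: emeasure_eq_measure)
  qed
  show ?thesis
  proof
    show "0 < \<beta>" using C'(2) pos by (auto simp: \<beta>_def)
    fix c assume "c \<in> C"
    then obtain c' where c': "c' \<in> C'" "c \<in> ball c' (e/2)" using C' by blast
    have "\<beta> \<le> measure p (ball c' (e/2))" using c' C'(2) by (auto simp: \<beta>_def)
    also have "\<dots> \<le> measure p (ball c e)"
    proof (rule finite_measure_mono)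
      have "dist c x < e" if "dist c' x < e / 2" for x
        using that c'(2) dist_triangle[of c x c'] by (auto simp: dist_commute)
      then show "ball c' (e/2) \<subseteq> ball c e" by auto
    qed (simp add: p)
    finally show "\<beta> \<le> measure p (ball c e)" .
  qed
qed

text \<open>
  If \<open>y + w\<close> misses the convex set for some small \<open>w\<close>, a separating hyperplane pushes all
  \<open>w\<close> near a boundary point of the ball in the support away from the set.
\<close>

lemma hit_or_miss_convex_set:
  fixes p :: "'a::euclidean_space measure"
  assumes p: "prob_space p" "sets p = sets borel"
    and r: "0 < r" "cball 0 r \<subseteq> measure_support p"
    and S: "convex S" "closed S" "S \<noteq> {}"
  obtains \<beta> where "0 < \<beta>"
    "\<And>y. \<beta> \<le> measure p {w. y + w \<in> S} \<or> \<beta> \<le> measure p {w. r / 4 \<le> infdist (y + w) S}"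
proof -
  interpret prob_space p by fact
  obtain \<beta> where \<beta>: "0 < \<beta>" "\<And>c. c \<in> cball 0 r \<Longrightarrow> \<beta> \<le> measure p (ball c (r/4))"
    using uniform_ball_measure[OF p compact_cball r(2), of "r/4"] r(1) by auto
  have S_meas: "{w. y + w \<in> S} \<in> sets p" for y
  proof -
    have "closed ((\<lambda>w. y + w) -` S)" 
      using S(2) by (intro closed_vimage continuous_intros) auto
    then show ?thesis by (simp add: p vimage_def)
  qed
  have far_meas: "{w. r / 4 \<le> infdist (y + w) S} \<in> sets p" for y
  proof -
    have "closed {w. r / 4 \<le> infdist (y + w) S}"
      by (intro closed_Collect_le continuous_intros)
    then show ?thesis by (simp add: p)
  qed
  have "\<beta> \<le> measure p {w. y + w \<in> S} \<or> \<beta> \<le> measure p {w. r / 4 \<le> infdist (y + w) S}" for y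
  proof (cases "ball y (r/4) \<subseteq> S")
    case True
    have "ball 0 (r/4) \<subseteq> {w. y + w \<in> S}"
      using True by (auto simp: subset_iff dist_norm)
    then have "measure p (ball 0 (r/4)) \<le> measure p {w. y + w \<in> S}"
      by (intro finite_measure_mono S_meas)
    then show ?thesis using \<beta>(2)[of 0] r(1) by auto
  next
    case False
    then obtain z where z: "dist y z < r/4" "z \<notin> S" unfolding subset_iff mem_ball by blast
    obtain a b where ab: "a \<bullet> z < b" "\<forall>x\<in>S. b < a \<bullet> x"
      using separating_hyperplane_closed_point[OF S(1,2) z(2)] by blast
    have "a \<noteq> 0" using ab S(3) by fastforce
    define s where "s = sgn a"
    have s: "norm s = 1" using \<open>a \<noteq> 0\<close> by (simp add: s_def norm_sgn)
    have sep: "s \<bullet> z < s \<bullet> x" if "x \<in> S" for x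
      using ab that \<open>a \<noteq> 0\<close> by (auto simp: s_def sgn_div_norm intro!: mult_strict_left_mono)
    have le: "s \<bullet> v \<le> norm v" for v using norm_cauchy_schwarz[of s v] s by simp
    \<comment> \<open>In the direction of the unit normal \<open>s\<close>, \<open>y\<close> exceeds
      \<open>z\<close> by at most \<open>r / 4\<close>, while \<open>w\<close> contributes at most
      \<open>- 3 * r / 4\<close>. So \<open>y + w\<close> falls short of every point of
      \<open>S\<close> by more than \<open>r / 2\<close>.\<close>
    have "r / 4 \<le> infdist (y + w) S" if w: "w \<in> ball (- r *\<^sub>R s) (r/4)" for w
    proof -
      have "r / 4 \<le> dist (y + w) x" if "x \<in> S" for x
      proof -
        have "s \<bullet> (y - z) \<le> r / 4" using le[of "y - z"] z(1) by (simp add: dist_norm)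
        moreover have "s \<bullet> (w + r *\<^sub>R s) \<le> r / 4"
          using le[of "w + r *\<^sub>R s"] w by (simp add: dist_norm norm_minus_commute add.commute)
        moreover have "s \<bullet> (x - (y + w)) \<le> dist (y + w) x"
          using le[of "x - (y + w)"] by (simp add: dist_norm norm_minus_commute)
        moreover have "s \<bullet> s = 1" using s by (simp add: dot_square_norm)
        ultimately show ?thesis using sep[OF that] r(1) by (simp add: inner_simps)
      qed
      then show ?thesis unfolding infdist_notempty[OF S(3)] by (intro cINF_greatest S(3))
    qed
    then have "measure p (ball (- r *\<^sub>R s) (r/4)) \<le> measure p {w. r / 4 \<le> infdist (y + w) S}"
      by (intro finite_measure_mono far_meas) auto
    then show ?thesis using \<beta>(2)[of "- r *\<^sub>R s"] s r(1) by auto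
  qed
  with \<beta>(1) show ?thesis using that by blast
qed

section \<open>One-step expectations and convergence in probability\<close>

lemma telescoping_imp_tendsto_0:
  fixes a L :: "nat \<Rightarrow> real"
  assumes a: "\<And>k. 0 \<le> a k" "\<And>k. a k \<le> L k - L (Suc k)" and L: "\<And>k. 0 \<le> L k"
  shows "a \<longlonglongrightarrow> 0"
proof -
  have "L (Suc k) \<le> L k" for k using a(1,2)[of k] by linarith
  then have "decseq L" by (rule decseq_SucI)
  then obtain b where b: "L \<longlonglongrightarrow> b"
    using decseq_convergent[of L 0] L by blast
  then have "(\<lambda>k. L k - L (Suc k)) \<longlonglongrightarrow> b - b"
    by (intro tendsto_diff LIMSEQ_Suc)
  then have "(\<lambda>k. L k - L (Suc k)) \<longlonglongrightarrow> 0" by simp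
  with tendsto_const show ?thesis
    by (rule tendsto_sandwich[rotated 2]) (simp_all add: a)
qed

text \<open>The state at time \<open>k\<close> depends on the first \<open>k\<close> disturbances only.\<close>

lemma (in prob_space) indep_var_state_disturbance:
  fixes w x :: "nat \<Rightarrow> 'a \<Rightarrow> 'b::euclidean_space"
  assumes w: "indep_vars (\<lambda>_. borel) w UNIV" and f: "f \<in> borel_measurable borel"
    and x: "\<And>\<omega>. x 0 \<omega> = x0" "\<And>k \<omega>. x (Suc k) \<omega> = f (x k \<omega>) + w k \<omega>"
  shows "indep_var borel (x k) borel (w k)"
proof -
  have "\<exists>G\<in>measurable (PiM {..<k} (\<lambda>_. borel)) borel. \<forall>\<omega>. x k \<omega> = G (restrict (\<lambda>i. w i \<omega>) {..<k})"
  proof (induction k)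
    case 0
    show ?case by (rule bexI[of _ "\<lambda>_. x0"]) (auto simp: x)
  next
    case (Suc k)
    then obtain G where G [measurable]: "G \<in> measurable (PiM {..<k} (\<lambda>_. borel)) borel"
      and xG: "\<And>\<omega>. x k \<omega> = G (restrict (\<lambda>i. w i \<omega>) {..<k})" by blast
    note f [measurable]
    have [measurable]: "(\<lambda>v. restrict v {..<k}) \<in>
        measurable (PiM {..<Suc k} (\<lambda>_. borel)) (PiM {..<k} (\<lambda>_. borel :: 'b measure))"
      by (rule measurable_restrict_subset) auto
    have [measurable]: "(\<lambda>v. v k) \<in> measurable (PiM {..<Suc k} (\<lambda>_. borel)) (borel :: 'b measure)"
      by (rule measurable_component_singleton) auto
    show ?case
    proof (rule bexI)
      show "\<forall>\<omega>. x (Suc k) \<omega> = (\<lambda>v. f (G (restrict v {..<k})) + v k) (restrict (\<lambda>i. w i \<omega>) {..<Suc k})"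
        by (auto simp: x xG Int_absorb1 lessThan_subset_iff)
    qed measurable
  qed
  then obtain G where G: "G \<in> measurable (PiM {..<k} (\<lambda>_. borel)) borel"
    and xG: "\<And>\<omega>. x k \<omega> = G (restrict (\<lambda>i. w i \<omega>) {..<k})" by blast
  have "indep_var (PiM {..<k} (\<lambda>_. borel)) (\<lambda>\<omega>. restrict (\<lambda>i. w i \<omega>) {..<k})
      (PiM {k} (\<lambda>_. borel)) (\<lambda>\<omega>. restrict (\<lambda>i. w i \<omega>) {k})"
    by (rule indep_var_restrict[OF w]) auto
  from indep_var_compose[OF this G, of "\<lambda>v. v k" borel]
  have "indep_var borel (G \<circ> (\<lambda>\<omega>. restrict (\<lambda>i. w i \<omega>) {..<k})) borel ((\<lambda>v. v k) \<circ> (\<lambda>\<omega>. restrict (\<lambda>i. w i \<omega>) {k}))"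
    by simp
  then show ?thesis by (simp add: comp_def xG[symmetric])
qed

text \<open>State and current disturbance are independent, so their joint law is a product measure
  and Fubini integrates the disturbance out first. This replaces a conditional expectation given the
  state.\<close>

lemma (in prob_space) expectation_next_state:
  fixes w x :: "nat \<Rightarrow> 'a \<Rightarrow> 'b::euclidean_space" and g :: "'b \<Rightarrow> real"
  assumes w: "indep_vars (\<lambda>_. borel) w UNIV" "\<And>k. distr M borel (w k) = p"
    and f: "f \<in> borel_measurable borel"
    and x: "\<And>\<omega>. x 0 \<omega> = x0" "\<And>k \<omega>. x (Suc k) \<omega> = f (x k \<omega>) + w k \<omega>"
    and g: "g \<in> borel_measurable borel" "\<And>y. \<bar>g y\<bar> \<le> C"
  shows "expectation (\<lambda>\<omega>. g (x (Suc k) \<omega>)) = expectation (\<lambda>\<omega>. LINT v|p. g (f (x k \<omega>) + v))"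
    and "integrable M (\<lambda>\<omega>. LINT v|p. g (f (x k \<omega>) + v))"
proof -
  have ind: "indep_var borel (x k) borel (w k)"
    by (rule indep_var_state_disturbance[OF w(1) f x])
  note [measurable] = f g(1)
  have xk [measurable]: "random_variable borel (x k)" and wk [measurable]: "random_variable borel (w k)"
    using ind by (rule indep_var_rv1, rule indep_var_rv2)
  have eq: "distr M borel (x k) \<Otimes>\<^sub>M p = distr M (borel \<Otimes>\<^sub>M borel) (\<lambda>\<omega>. (x k \<omega>, w k \<omega>))"
    using ind unfolding indep_var_distribution_eq w(2) by simp
  interpret X: prob_space "distr M borel (x k)" by (rule prob_space_distr) measurable
  interpret p: prob_space p
    using prob_space_distr[OF wk] w(2)[of k] by simp
  interpret XP: pair_prob_space "distr M borel (x k)" p ..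
  have sets_p [measurable_cong]: "sets p = sets borel"
    using w(2)[of k] by (metis sets_distr)
  have int: "integrable (distr M borel (x k) \<Otimes>\<^sub>M p) (\<lambda>(y, v). g (f y + v))"
    by (rule XP.integrable_const_bound[of _ C]) (use g(2) in auto)
  have "expectation (\<lambda>\<omega>. g (x (Suc k) \<omega>)) = (LINT z|(distr M borel (x k) \<Otimes>\<^sub>M p). (case z of (y, v) \<Rightarrow> g (f y + v)))"
    unfolding eq by (subst integral_distr) (auto simp: x)
  also have "\<dots> = (LINT y|distr M borel (x k). LINT v|p. g (f y + v))"
    using XP.integral_fst[OF int] by simp
  also have "\<dots> = expectation (\<lambda>\<omega>. LINT v|p. g (f (x k \<omega>) + v))"
    by (rule integral_distr) measurable
  finally show "expectation (\<lambda>\<omega>. g (x (Suc k) \<omega>)) = expectation (\<lambda>\<omega>. LINT v|p. g (f (x k \<omega>) + v))" .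
  have "integrable (distr M borel (x k)) (\<lambda>y. LINT v|p. g (f y + v))"
    using XP.integrable_fst[OF int] by simp
  then show "integrable M (\<lambda>\<omega>. LINT v|p. g (f (x k \<omega>) + v))"
    by (rule integrable_distr[OF xk])
qed

lemma (in prob_space) AE_invariant_state:
  fixes w x :: "nat \<Rightarrow> 'a \<Rightarrow> 'b::euclidean_space"
  assumes w: "\<And>k. random_variable borel (w k)" "\<And>k. distr M borel (w k) = p"
    and x: "\<And>\<omega>. x 0 \<omega> = x0" "\<And>k \<omega>. x (Suc k) \<omega> = f (x k \<omega>) + w k \<omega>"
    and W: "AE v in p. v \<in> W"
    and S: "x0 \<in> S" "\<And>y v. y \<in> S \<Longrightarrow> v \<in> W \<Longrightarrow> f y + v \<in> S"
  shows "AE \<omega> in M. \<forall>k. x k \<omega> \<in> S"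
proof -
  have "AE \<omega> in M. w k \<omega> \<in> W" for k
    using W by (subst (asm) w(2)[of k, symmetric]) (rule AE_distrD[OF w(1)])
  then have "AE \<omega> in M. \<forall>k. w k \<omega> \<in> W" by (simp add: AE_all_countable)
  then show ?thesis
  proof eventually_elim
    case (elim \<omega>)
    have "x k \<omega> \<in> S" for k by (induction k) (use elim S x in auto)
    then show ?case ..
  qed
qed

text \<open>Two recursions are combined: the Lyapunov function \<open>q\<close> pays
  \<open>c\<close> for every visit at distance at least \<open>r / 4\<close> from \<open>G\<close>,
  and the hit-or-miss alternative contracts the probability of being outside \<open>G\<close> up to
  the probability of such a visit at the next time.\<close>

lemma (in prob_space) prob_state_in_target_tendsto_1:
  fixes w x :: "nat \<Rightarrow> 'a \<Rightarrow> 'b::euclidean_space" and q :: "'b \<Rightarrow> real"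
  assumes w: "indep_vars (\<lambda>_. borel) w UNIV" "\<And>k. distr M borel (w k) = p"
    and f: "f \<in> borel_measurable borel"
    and x: "\<And>\<omega>. x 0 \<omega> = x0" "\<And>k \<omega>. x (Suc k) \<omega> = f (x k \<omega>) + w k \<omega>"
    and S: "x0 \<in> S" "\<And>y v. y \<in> S \<Longrightarrow> v \<in> measure_support p \<Longrightarrow> f y + v \<in> S"
    and r: "0 < r" "cball 0 r \<subseteq> measure_support p"
    and G: "convex G" "closed G" "G \<noteq> {}"
    and invariant: "\<And>y. y \<in> S \<Longrightarrow> y \<in> G \<Longrightarrow> AE v in p. f y + v \<in> G"
    and q: "q \<in> borel_measurable borel" "\<And>y. 0 \<le> q y" "\<And>y. q y \<le> C"
    and c: "0 < c"
    and decrease: "\<And>y. y \<in> S \<Longrightarrow>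
      (LINT v|p. q (f y + v)) \<le> q y - c * indicator {z. r / 4 \<le> infdist z G} y"
  shows "(\<lambda>k. prob {\<omega> \<in> space M. x k \<omega> \<in> G}) \<longlonglongrightarrow> 1"
proof -
  have wk [measurable]: "random_variable borel (w k)" for k
    using w(1) by (auto simp: indep_vars_def)
  note [measurable] = f q(1)
  have xk [measurable]: "random_variable borel (x k)" for k
    by (rule indep_var_rv1[OF indep_var_state_disturbance[OF w(1) f x]])
  have sets_p [measurable_cong]: "sets p = sets borel"
    using w(2)[of 0] by (metis sets_distr)
  have pp: "prob_space p" using prob_space_distr[OF wk[of 0]] w(2)[of 0] by simp
  interpret p: prob_space p by fact
  define far where "far = {z. r / 4 \<le> infdist z G}"
  have G_meas [measurable]: "G \<in> sets borel" using G by simp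
  have far_meas [measurable]: "far \<in> sets borel"
    unfolding far_def by (intro borel_closed closed_Collect_le continuous_intros)
  obtain \<beta> where \<beta>: "0 < \<beta>"
    "\<And>y. \<beta> \<le> measure p {w. y + w \<in> G} \<or> \<beta> \<le> measure p {w. r / 4 \<le> infdist (y + w) G}"
    using hit_or_miss_convex_set[OF pp sets_p r G] by blast
  have inS: "AE \<omega> in M. \<forall>k. x k \<omega> \<in> S"
    by (rule AE_invariant_state[OF wk w(2) x AE_in_measure_support[OF sets_p] S])
  \<comment> \<open>Both probabilities are written as expectations of indicators, to which
    \<open>expectation_next_state\<close> applies.\<close>
  define a :: "nat \<Rightarrow> real" where "a k = expectation (\<lambda>\<omega>. indicator (- G) (x k \<omega>))" for k
  define b :: "nat \<Rightarrow> real" where "b k = expectation (\<lambda>\<omega>. indicator far (x k \<omega>))" for k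
  define e where "e k = expectation (\<lambda>\<omega>. q (x k \<omega>))" for k
  have int_ind: "integrable M (\<lambda>\<omega>. indicator A (x k \<omega>) :: real)" if [measurable]: "A \<in> sets borel" for A k
    by (rule integrable_const_bound[of _ 1]) auto
  have int_q: "integrable M (\<lambda>\<omega>. q (x k \<omega>))" for k
    by (rule integrable_const_bound[of _ C]) (use q in auto)
  have q_abs: "\<bar>q y\<bar> \<le> C" for y using q(2,3)[of y] by simp
  have int_ind_p: "integrable p (\<lambda>v. indicator A (y + v) :: real)" if [measurable]: "A \<in> sets borel" for A y
    by (rule p.integrable_const_bound[of _ 1]) auto
  have e_step: "e (Suc k) \<le> e k - c * b k" for k
  proof -
    have "e (Suc k) = expectation (\<lambda>\<omega>. LINT v|p. q (f (x k \<omega>) + v))"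
      unfolding e_def by (rule expectation_next_state(1)[OF w f x q(1) q_abs])
    also have "\<dots> \<le> expectation (\<lambda>\<omega>. q (x k \<omega>) - c * indicator far (x k \<omega>))"
    proof (rule integral_mono_AE)
      show "integrable M (\<lambda>\<omega>. LINT v|p. q (f (x k \<omega>) + v))"
        by (rule expectation_next_state(2)[OF w f x q(1) q_abs])
      show "AE \<omega> in M. (LINT v|p. q (f (x k \<omega>) + v)) \<le> q (x k \<omega>) - c * indicator far (x k \<omega>)"
        using inS by eventually_elim (use decrease in \<open>auto simp: far_def\<close>)
    qed (intro Bochner_Integration.integrable_diff integrable_mult_right int_q int_ind far_meas)
    also have "\<dots> = e k - c * b k"
      using int_q int_ind[OF far_meas] by (simp add: e_def b_def)
    finally show ?thesis .
  qed
  \<comment> \<open>From inside \<open>G\<close> the left side is 0 by invariance. From outside,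
    either the probability of missing \<open>G\<close> is at most \<open>1 - \<beta>\<close>, or the
    far event has probability at least \<open>\<beta>\<close> and makes up for the missing
    \<open>\<beta>\<close>.\<close>
  have hit: "(LINT v|p. indicator (- G) (f y + v)) \<le>
      (1 - \<beta>) * indicator (- G) y + (LINT v|p. indicator far (f y + v))" if y: "y \<in> S" for y
  proof (cases "y \<in> G")
    case True
    have "(LINT v|p. indicator (- G) (f y + v)) = (LINT v|p. (0::real))"
      by (rule integral_cong_AE) (use invariant[OF y True] in \<open>auto simp: indicator_def elim!: eventually_mono\<close>)
    then show ?thesis using True by simp
  next
    case False
    have eq: "(LINT v|p. indicator A (f y + v) :: real) = measure p {v. f y + v \<in> A}"
      if [measurable]: "A \<in> sets borel" for A
    proof -
      have "(LINT v|p. indicator A (f y + v) :: real) = (LINT v|p. indicator {v. f y + v \<in> A} v)"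
        by (intro Bochner_Integration.integral_cong) (auto simp: indicator_def)
      then show ?thesis by (simp add: sets_eq_imp_space_eq[OF sets_p])
    qed
    have "measure p {v. f y + v \<in> - G} = 1 - measure p {v. f y + v \<in> G}"
    proof -
      have "{v. f y + v \<in> G} \<in> sets p" by measurable
      from p.prob_compl[OF this] show ?thesis
        by (simp add: sets_eq_imp_space_eq[OF sets_p] Compl_eq_Diff_UNIV[symmetric] Collect_neg_eq)
    qed
    moreover have "\<beta> \<le> 1" using \<beta>(2)[of 0] p.prob_le_1 by (meson order_trans)
    moreover have "0 \<le> measure p {v. f y + v \<in> G}" "0 \<le> measure p {v. f y + v \<in> far}" by simp_all
    moreover have "\<beta> \<le> measure p {v. f y + v \<in> G} \<or> \<beta> \<le> measure p {v. f y + v \<in> far}"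
      using \<beta>(2)[of "f y"] by (simp add: far_def)
    moreover have "(1 - \<beta>) * indicator (- G) y = 1 - \<beta>" using False by simp
    moreover have "- G \<in> sets borel" using G_meas by simp
    ultimately show ?thesis unfolding eq[OF \<open>- G \<in> sets borel\<close>] eq[OF far_meas] by linarith
  qed
  have a_step: "a (Suc k) \<le> (1 - \<beta>) * a k + b (Suc k)" for k
  proof -
    have m: "(indicator (- G) :: 'b \<Rightarrow> real) \<in> borel_measurable borel"
      "(indicator far :: 'b \<Rightarrow> real) \<in> borel_measurable borel" by measurable
    have bd: "\<bar>indicator A y :: real\<bar> \<le> 1" for A and y :: 'b by (simp add: indicator_def)
    note step = expectation_next_state[OF w f x m(1) bd] expectation_next_state[OF w f x m(2) bd]
    have "a (Suc k) = expectation (\<lambda>\<omega>. LINT v|p. indicator (- G) (f (x k \<omega>) + v))"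
      unfolding a_def by (rule step)
    also have "\<dots> \<le> expectation (\<lambda>\<omega>. (1 - \<beta>) * indicator (- G) (x k \<omega>)
        + (LINT v|p. indicator far (f (x k \<omega>) + v)))"
    proof (rule integral_mono_AE)
      show "integrable M (\<lambda>\<omega>. LINT v|p. indicator (- G) (f (x k \<omega>) + v) :: real)"
        by (rule step)
      show "integrable M (\<lambda>\<omega>. (1 - \<beta>) * indicator (- G) (x k \<omega>)
        + (LINT v|p. indicator far (f (x k \<omega>) + v)))"
        by (intro Bochner_Integration.integrable_add integrable_mult_right int_ind step) auto
      show "AE \<omega> in M. (LINT v|p. indicator (- G) (f (x k \<omega>) + v)) \<le>
          (1 - \<beta>) * indicator (- G) (x k \<omega>) + (LINT v|p. indicator far (f (x k \<omega>) + v))"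
        using inS by eventually_elim (use hit in auto)
    qed
    also have "\<dots> = (1 - \<beta>) * a k + b (Suc k)"
      using int_ind step unfolding a_def b_def by (subst Bochner_Integration.integral_add) auto
    finally show ?thesis .
  qed
  \<comment> \<open>The telescoping quantity is \<open>a k + e (Suc k) / c\<close>. The index of
    \<open>e\<close> is shifted because the error term is \<open>b (Suc k)\<close>, which is paid
    for by the drop from \<open>e (Suc k)\<close> to \<open>e (Suc (Suc k))\<close>.\<close>
  have "(\<lambda>k. \<beta> * a k) \<longlonglongrightarrow> 0"
  proof (rule telescoping_imp_tendsto_0)
    fix k
    show "0 \<le> \<beta> * a k" using \<beta>(1) by (simp add: a_def)
    show "0 \<le> a k + e (Suc k) / c" using c q(2) by (simp add: a_def e_def)
    have "b (Suc k) \<le> e (Suc k) / c - e (Suc (Suc k)) / c"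
      using e_step[of "Suc k"] c by (simp add: field_simps)
    then show "\<beta> * a k \<le> (a k + e (Suc k) / c) - (a (Suc k) + e (Suc (Suc k)) / c)"
      using a_step[of k] by (simp add: algebra_simps)
  qed
  from tendsto_mult_left[OF this, of "1 / \<beta>"] have "a \<longlonglongrightarrow> 0" using \<beta>(1) by simp
  then have "(\<lambda>k. 1 - a k) \<longlonglongrightarrow> 1 - 0" by (intro tendsto_intros)
  moreover have "prob {\<omega> \<in> space M. x k \<omega> \<in> G} = 1 - a k" for k
  proof -
    have "a k = expectation (indicator {\<omega> \<in> space M. x k \<omega> \<notin> G})"
      unfolding a_def by (intro Bochner_Integration.integral_cong) (auto simp: indicator_def)
    also have "\<dots> = prob {\<omega> \<in> space M. x k \<omega> \<notin> G}" by simp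
    also have "{\<omega> \<in> space M. x k \<omega> \<notin> G} = space M - {\<omega> \<in> space M. x k \<omega> \<in> G}" by auto
    also have "prob \<dots> = 1 - prob {\<omega> \<in> space M. x k \<omega> \<in> G}" by (rule prob_compl) measurable
    finally show ?thesis by simp
  qed
  ultimately show ?thesis by simp
qed

section \<open>Nonnegativity of the stage cost\<close>

text \<open>The point may lie on the boundary of \<open>S\<close>, so only the one-sided limit along
  the segment inside \<open>S\<close> is meaningful; it comes from the chain rule within
  \<open>{0..1}\<close>.\<close>

lemma directional_derivative_tendsto:
  fixes L :: "'a::real_normed_vector \<Rightarrow> real"
  assumes L: "(L has_derivative L') (at a within S)"
    and d: "\<And>s. 0 \<le> s \<Longrightarrow> s \<le> 1 \<Longrightarrow> a + s *\<^sub>R d \<in> S"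
  shows "((\<lambda>s. (L (a + s *\<^sub>R d) - L a) / s) \<longlongrightarrow> L' d) (at_right 0)"
proof -
  have g: "((\<lambda>s. a + s *\<^sub>R d) has_derivative (\<lambda>s. s *\<^sub>R d)) (at 0 within {0..1})"
    by (auto intro!: derivative_eq_intros)
  have "(L has_derivative L') (at (a + 0 *\<^sub>R d) within (\<lambda>s. a + s *\<^sub>R d) ` {0..1})"
    using d has_derivative_subset[OF L, of "(\<lambda>s. a + s *\<^sub>R d) ` {0..1}"]
    by (simp add: image_subset_iff)
  from has_derivative_in_compose[OF g this]
  have "((\<lambda>s. L (a + s *\<^sub>R d)) has_derivative (\<lambda>s. L' (s *\<^sub>R d))) (at 0 within {0..1})" .
  moreover have "L' (s *\<^sub>R d) = L' d * s" for s
    using linear_scale[OF has_derivative_linear[OF L]] by (simp add: mult.commute)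
  ultimately have "((\<lambda>s. L (a + s *\<^sub>R d)) has_field_derivative L' d) (at 0 within {0..1})"
    by (simp add: has_field_derivative_def)
  then have "((\<lambda>s. (L (a + s *\<^sub>R d) - L a) / s) \<longlongrightarrow> L' d) (at 0 within {0..1})"
    by (simp add: has_field_derivative_iff)
  then show ?thesis
    by (simp add: at_within_Icc_at_right)
qed

text \<open>
  At a point \<open>b\<close> of the target set that is a limit of states outside of it, continuity gives
  \<open>l b u \<ge> 0\<close> for all \<open>u\<close>. If \<open>l x u < 0\<close> for a state \<open>x\<close> of the target set, then
  convexity makes the derivative of \<open>l\<close> at \<open>(b, \<kappa> x)\<close> negative in direction
  \<open>(x - b, u - \<kappa> x)\<close>, whereas it vanishes in direction \<open>(x - b, 0)\<close> and is nonnegative in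
  direction \<open>(0, u - \<kappa> x)\<close>.
\<close>

lemma stage_cost_nonneg:
  fixes l :: "'a::euclidean_space \<Rightarrow> 'b::euclidean_space \<Rightarrow> real"
  assumes X: "convex X" and U: "convex U"
    and G: "compact G" "convex G" "G \<subseteq> X" and z: "z \<in> X - G"
    and diff: "(\<lambda>(x, u). l x u) differentiable_on (X \<times> U)"
    and conv: "convex_on (X \<times> U) (\<lambda>(x, u). l x u)"
    and zero: "\<And>x y. x \<in> G \<Longrightarrow> y \<in> G \<Longrightarrow> l x (\<kappa> y) = 0" "\<kappa> ` G \<subseteq> U"
    and pos: "\<And>x u. x \<in> X - G \<Longrightarrow> u \<in> U \<Longrightarrow> 0 < l x u"
    and x: "x \<in> X" and u: "u \<in> U"
  shows "0 \<le> l x u"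
proof (cases "x \<in> G")
  case False
  then show ?thesis using pos[of x u] x u by simp
next
  case xG: True
  define L where "L = (\<lambda>(x, u). l x u)"
  \<comment> \<open>The segment leaves the target on its way from \<open>x\<close> to
    \<open>z\<close>. Its last parameter \<open>t\<close> with \<open>g t \<in> G\<close> yields the
    boundary point \<open>b\<close>, and all later points of the segment lie in
    \<open>X - G\<close>.\<close>
  define g where "g s = x + s *\<^sub>R (z - x)" for s :: real
  have gX: "g s \<in> X" if "0 \<le> s" "s \<le> 1" for s
    using convexD_alt[OF X x, of z s] that z by (simp add: g_def algebra_simps)
  have "compact ({0..1} \<inter> g -` G)"
    using G(1) unfolding g_def
    by (intro compact_Int_closed closed_vimage continuous_intros compact_imp_closed) auto
  moreover have "0 \<in> {0..1} \<inter> g -` G" using xG by (simp add: g_def)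
  ultimately obtain t where "t \<in> {0..1} \<inter> g -` G" "\<And>s. s \<in> {0..1} \<inter> g -` G \<Longrightarrow> s \<le> t"
    using compact_attains_sup[of "{0..1} \<inter> g -` G"] by blast
  then have t: "0 \<le> t" "t \<le> 1" "g t \<in> G"
    and t_max: "\<And>s. 0 \<le> s \<Longrightarrow> s \<le> 1 \<Longrightarrow> g s \<in> G \<Longrightarrow> s \<le> t"
    by auto
  have "t < 1" using t z by (cases "t = 1") (auto simp: g_def)
  define b where "b = g t"
  have bG: "b \<in> G" using t by (simp add: b_def)
  have b_nonneg: "0 \<le> l b u'" if u': "u' \<in> U" for u'
  proof -
    define s where "s n = t + (1 - t) * inverse (real (Suc n))" for n
    have s: "t < s n" "s n \<le> 1" for n
    proof -
      show "t < s n" using \<open>t < 1\<close> by (simp add: s_def)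
      have "s n \<le> t + (1 - t) * 1"
        unfolding s_def using \<open>t < 1\<close>
        by (intro add_left_mono mult_left_mono) (simp_all add: inverse_le_1_iff)
      then show "s n \<le> 1" by simp
    qed
    have "s \<longlonglongrightarrow> t + (1 - t) * 0"
      unfolding s_def by (intro tendsto_intros LIMSEQ_inverse_real_of_nat)
    then have "(\<lambda>n. (g (s n), u')) \<longlonglongrightarrow> (b, u')"
      unfolding b_def g_def by (intro tendsto_intros) simp
    moreover have "continuous_on (X \<times> U) L"
      unfolding L_def by (rule differentiable_imp_continuous_on[OF diff])
    moreover have "(g (s n), u') \<in> X \<times> U" for n
      using gX[of "s n"] s[of n] t u' by auto
    moreover have "(b, u') \<in> X \<times> U" using bG G u' by auto
    ultimately have "(\<lambda>n. L (g (s n), u')) \<longlonglongrightarrow> L (b, u')"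
      using continuous_on_tendsto_compose[of "X \<times> U" L "\<lambda>n. (g (s n), u')" "(b, u')" sequentially]
      by simp
    moreover have "0 \<le> L (g (s n), u')" for n
    proof -
      have "g (s n) \<in> X - G" using t_max[of "s n"] s[of n] t gX[of "s n"] by force
      from pos[OF this u'] show ?thesis by (simp add: L_def)
    qed
    ultimately have "0 \<le> L (b, u')" by (intro LIMSEQ_le_const) auto
    then show ?thesis by (simp add: L_def)
  qed
  \<comment> \<open>The input belongs to \<open>x\<close>, not to \<open>b\<close>. The cost
    vanishes for any target state paired with the feedback at any other target state, so it is 0 on
    the whole segment from \<open>b\<close> to \<open>x\<close> with \<open>u1\<close>
    fixed.\<close>
  define u1 where "u1 = \<kappa> x"
  have u1: "u1 \<in> U" using zero(2) xG by (auto simp: u1_def)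
  have l_u1: "l y u1 = 0" if "y \<in> G" for y using zero(1) that xG by (simp add: u1_def)
  have seg: "b + s *\<^sub>R (x - b) \<in> G" "u1 + s *\<^sub>R (u - u1) \<in> U" if "0 \<le> s" "s \<le> 1" for s
    using convexD_alt[OF G(2) bG xG, of s] convexD_alt[OF U u1 u, of s] that
    by (simp_all add: algebra_simps)
  obtain L' where L': "(L has_derivative L') (at (b, u1) within (X \<times> U))"
    using diff bG G u1 unfolding differentiable_on_def differentiable_def L_def by blast
  note dd = directional_derivative_tendsto[OF L']
  have ev: "eventually (\<lambda>s. 0 < s \<and> s < 1) (at_right (0::real))"
    by (rule eventually_at_rightI[of 0 1]) auto
  have "((\<lambda>s. (L ((b, u1) + s *\<^sub>R (x - b, 0)) - L (b, u1)) / s) \<longlongrightarrow> L' (x - b, 0)) (at_right 0)"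
    using seg G u1 by (intro dd) auto
  moreover have "eventually (\<lambda>s. 0 \<le> (L ((b, u1) + s *\<^sub>R (x - b, 0)) - L (b, u1)) / s) (at_right 0)"
    using ev by eventually_elim (use seg bG l_u1 in \<open>simp add: L_def\<close>)
  ultimately have 1: "0 \<le> L' (x - b, 0)" by (intro tendsto_lowerbound) auto
  have "((\<lambda>s. (L ((b, u1) + s *\<^sub>R (0, u - u1)) - L (b, u1)) / s) \<longlongrightarrow> L' (0, u - u1)) (at_right 0)"
    using seg G bG by (intro dd) auto
  moreover have "eventually (\<lambda>s. 0 \<le> (L ((b, u1) + s *\<^sub>R (0, u - u1)) - L (b, u1)) / s) (at_right 0)"
    using ev by eventually_elim (use seg bG l_u1 b_nonneg in \<open>simp add: L_def\<close>)
  ultimately have 2: "0 \<le> L' (0, u - u1)" by (intro tendsto_lowerbound) auto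
  have "((\<lambda>s. (L ((b, u1) + s *\<^sub>R (x - b, u - u1)) - L (b, u1)) / s) \<longlongrightarrow> L' (x - b, u - u1)) (at_right 0)"
    using seg G by (intro dd) auto
  moreover have "eventually (\<lambda>s. (L ((b, u1) + s *\<^sub>R (x - b, u - u1)) - L (b, u1)) / s \<le> l x u) (at_right 0)"
    using ev
  proof eventually_elim
    case (elim s)
    have "L ((1 - s) *\<^sub>R (b, u1) + s *\<^sub>R (x, u)) \<le> (1 - s) * L (b, u1) + s * L (x, u)"
      using conv elim bG G u1 x u unfolding L_def[symmetric] by (intro convex_onD) auto
    moreover have "(1 - s) *\<^sub>R (b, u1) + s *\<^sub>R (x, u) = (b, u1) + s *\<^sub>R (x - b, u - u1)"
      by (simp add: algebra_simps)
    ultimately show ?case using elim l_u1[OF bG] by (simp add: L_def divide_le_eq mult.commute)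
  qed
  ultimately have 3: "L' (x - b, u - u1) \<le> l x u" by (intro tendsto_upperbound) auto
  have "L' (x - b, u - u1) = L' (x - b, 0) + L' (0, u - u1)"
    using linear_add[OF has_derivative_linear[OF L'], of "(x - b, 0)" "(0, u - u1)"] by simp
  then show ?thesis using 1 2 3 by simp
qed

section \<open>Convergence of the closed loop\<close>

lemma convex_matrix_halfspaces: "convex {x :: real^'n. H *v x \<le> h}"
proof (rule convexI)
  fix x y :: "real^'n" and s t :: real
  assume xy: "x \<in> {x. H *v x \<le> h}" "y \<in> {x. H *v x \<le> h}" and st: "0 \<le> s" "0 \<le> t" "s + t = 1"
  have "(H *v (s *\<^sub>R x + t *\<^sub>R y)) $ i \<le> h $ i" for i
  proof -
    have "s * (H *v x) $ i + t * (H *v y) $ i \<le> s * h $ i + t * h $ i"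
      using xy st by (intro add_mono mult_left_mono) (auto simp: less_eq_vec_def)
    also have "\<dots> = h $ i" using st by (metis distrib_right mult_1)
    finally show ?thesis
      by (simp add: matrix_vector_right_distrib matrix_vector_mult_scaleR)
  qed
  then show "s *\<^sub>R x + t *\<^sub>R y \<in> {x. H *v x \<le> h}" by (simp add: less_eq_vec_def)
qed

text \<open>A fixed point of \<open>F\<close> in the set, given by Brouwer, must be the origin as 1 is no eigenvalue.\<close>

lemma zero_in_robust_invariant_set:
  fixes F :: "real^'n^'n"
  assumes F: "schur_stable F" and E: "compact E" "convex E" "E \<noteq> {}" "robust_invariant F W E"
    and W: "0 \<in> W"
  shows "0 \<in> E"
proof -
  have "(*v) F \<in> E \<rightarrow> E" using E(4) W by (force simp: robust_invariant_def)
  moreover have "continuous_on E ((*v) F)"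
    by (intro linear_continuous_on linear_conv_bounded_linear[THEN iffD1]) simp
  ultimately obtain e where e: "e \<in> E" "F *v e = e" using brouwer[OF E(1-3)] by metis
  define v :: "complex^'n" where "v = (\<chi> i. complex_of_real (e $ i))"
  have "(\<chi> i j. complex_of_real (F $ i $ j)) *v v = 1 *s v"
  proof (rule vec_eq_iff[THEN iffD2], rule allI)
    fix i
    have "((\<chi> i j. complex_of_real (F $ i $ j)) *v v) $ i = complex_of_real ((F *v e) $ i)"
      by (simp add: matrix_vector_mult_def v_def)
    then show "((\<chi> i j. complex_of_real (F $ i $ j)) *v v) $ i = (1 *s v) $ i"
      by (simp add: e v_def)
  qed
  then have "v = 0" using F unfolding schur_stable_def by (metis less_irrefl norm_one)
  then have "e = 0" by (simp add: v_def vec_eq_iff)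
  with e show ?thesis by simp
qed

lemma borel_measurable_linear_feedback:
  fixes A :: "real^'n^'n" and B :: "real^'u^'n"
  assumes "us \<in> borel_measurable borel"
  shows "(\<lambda>y. A *v y + B *v us y) \<in> borel_measurable borel"
proof -
  have lin_meas: "(\<lambda>x. H *v x) \<in> borel_measurable borel" for H :: "real^'b^'n"
    by (intro borel_measurable_continuous_onI linear_continuous_on linear_conv_bounded_linear[THEN iffD1]) simp
  show ?thesis by (intro borel_measurable_add lin_meas measurable_compose[OF assms lin_meas])
qed

lemma polytope_vertices:
  fixes S :: "'a::euclidean_space set"
  assumes "polytope S"
  shows "finite (vertices S)" "S = convex hull (vertices S)"
  unfolding vertices_def
  using assms by (simp_all add: finite_polyhedron_extreme_points polytope_imp_polyhedron
    Krein_Milman_Minkowski polytope_imp_compact polytope_imp_convex)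

context mpc_problem begin

lemma closed_loop_reaches_target:
  fixes p :: "(real^'n) measure" and P :: "'a measure" and w :: "nat \<Rightarrow> 'a \<Rightarrow> real^'n"
  assumes D: "feasible_data D" "costed_data D" and x0: "x0 \<in> safe_set D"
    and us: "\<And>x. inputs D x \<noteq> {} \<Longrightarrow> is_arg_min (objective D x) (\<lambda>u. u \<in> inputs D x) (us x)"
      "us \<in> borel_measurable borel"
    and iid: "prob_space P" "prob_space.indep_vars P (\<lambda>_. borel) w UNIV" "\<And>k. distr P borel (w k) = p"
    and W: "measure_support p = W" "0 \<in> interior W"
    and U: "compact U" and G: "compact G" "G \<noteq> {}"
    and \<mu>: "\<And>v m. v \<in> W \<Longrightarrow> m < M \<Longrightarrow> 0 \<le> \<mu> v m" "\<And>v. v \<in> W \<Longrightarrow> (\<Sum>m<M. \<mu> v m) = 1"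
      "\<And>v. v \<in> W \<Longrightarrow> v = (\<Sum>m<M. \<mu> v m *\<^sub>R wt m)"
    and pm: "\<And>m. m < M \<Longrightarrow> set_integrable p W (\<lambda>v. \<mu> v m)"
      "\<And>m. m < M \<Longrightarrow> pm m = (LINT v:W|p. \<mu> v m)"
    and l: "continuous_on (X \<times> U) (\<lambda>(x, u). l x u)"
      "\<And>x u. x \<in> X \<Longrightarrow> u \<in> U \<Longrightarrow> 0 \<le> l x u" "\<And>x u. x \<in> X - G \<Longrightarrow> u \<in> U \<Longrightarrow> 0 < l x u"
  shows "(\<lambda>k. measure P {\<omega> \<in> space P. closed_loop A B us x0 (\<lambda>k. w k \<omega>) k \<in> G}) \<longlonglongrightarrow> 1"
proof -
  interpret prob_space P by fact
  have w0: "w 0 \<in> borel_measurable P" using iid(2) by (auto simp: indep_vars_def)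
  have p: "prob_space p" "sets p = sets borel"
    using prob_space_distr[OF w0] iid(3)[of 0] by (auto simp: sets_distr)
  interpret p: prob_space p by fact
  have AE_W: "AE v in p. v \<in> W" using AE_in_measure_support[OF p(2)] W(1) by simp
  define f where "f y = A *v y + B *v us y" for y
  \<comment> \<open>Extended by 0 off the safe set, the value function is measurable, bounded and
    nonnegative everywhere and can serve as the Lyapunov function.\<close>
  define q where "q x = indicator (safe_set D) x * Q_fun D x" for x
  have fin: "finite D" by (rule finite_feasible_data[OF D(1)])
  have q_meas: "q \<in> borel_measurable borel"
    unfolding q_def by (rule borel_measurable_Q_fun[OF fin])
  have q_nonneg: "0 \<le> q x" for x
    using Q_fun_nonneg[OF fin D(2)] by (simp add: q_def indicator_def)
  obtain C where C: "\<And>x. \<bar>q x\<bar> \<le> C" using Q_fun_bounded[OF fin] unfolding q_def by blast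
  have f_meas: "f \<in> borel_measurable borel"
    unfolding f_def by (rule borel_measurable_linear_feedback[OF us(2)])
  have us_in: "us y \<in> inputs D y" if "y \<in> safe_set D" for y
    using us(1)[OF inputs_nonempty[OF D(1) that]] by (simp add: is_arg_min_def)
  have f_safe: "f y + v \<in> safe_set D" if "y \<in> safe_set D" "v \<in> W" for y v
    using inputsD(4)[OF us_in] that by (simp add: f_def)
  \<comment> \<open>The Jensen bound passes from the true disturbance to the samples; optimality
    against the interpolated input then bounds the objective by \<open>q y\<close>.\<close>
  have step: "(LINT v|p. q (f y + v)) \<le> q y - l y (us y)" if y: "y \<in> safe_set D" for y
  proof -
    have "f y \<in> safe_set D \<ominus> W" using us_in[OF y] by (simp add: f_def mpc_inputs_def)
    then have "(LINT v|p. q (f y + v)) \<le> (\<Sum>m<M. pm m * Q_fun D (f y + wt m))"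
      unfolding q_def by (intro expected_Q_fun_le[OF D(1) p AE_W \<mu> pm C[unfolded q_def]])
    also have "\<dots> = objective D y (us y) - l y (us y)"
      by (simp add: mpc_objective_def f_def)
    also have "\<dots> \<le> q y - l y (us y)"
      using objective_optimal_le_Q_fun[OF D y us(1)[OF inputs_nonempty[OF D(1) y]]] y
      by (simp add: q_def)
    finally show ?thesis .
  qed
  \<comment> \<open>At a target state \<open>q\<close> is 0 and the stage cost is nonnegative, so
    the nonnegative next value has mean at most 0 and vanishes almost surely. Zeros of
    \<open>Q_fun\<close> on the safe set lie in the target.\<close>
  have invariant: "AE v in p. f y + v \<in> G" if y: "y \<in> safe_set D" "y \<in> G" for y
  proof -
    have int: "integrable p (\<lambda>v. q (f y + v))"
      by (rule p.integrable_const_bound[of _ C])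
        (use C in \<open>auto intro!: measurable_compose[OF _ q_meas] simp: measurable_cong_sets[OF p(2)]\<close>)
    have "0 \<le> l y (us y)" using inputsD(1,2)[OF us_in[OF y(1)]] by (rule l(2))
    moreover have "q y = 0" using Q_fun_target(1)[OF fin D(2) y(2)] by (simp add: q_def)
    ultimately have "(LINT v|p. q (f y + v)) \<le> 0" using step[OF y(1)] by simp
    moreover have "0 \<le> (LINT v|p. q (f y + v))" using q_nonneg by simp
    ultimately have "(LINT v|p. q (f y + v)) = 0" by simp
    then have "AE v in p. q (f y + v) = 0"
      using integral_nonneg_eq_0_iff_AE[OF int] q_nonneg by simp
    with AE_W show ?thesis
    proof eventually_elim
      case (elim v)
      with f_safe[OF y(1)] have "Q_fun D (f y + v) = 0" "f y + v \<in> safe_set D" by (auto simp: q_def)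
      then show ?case using Q_fun_eq_0_imp_target[OF fin D(2)] by blast
    qed
  qed
  obtain r where r: "0 < r" "cball 0 r \<subseteq> W" using W(2) mem_interior_cball by metis
  \<comment> \<open>\<open>c\<close> is the minimum of the positive, continuous stage cost over the
    compact set of safe states far from the target, paired with all of \<open>U\<close>. If that set
    is empty, 1 is taken.\<close>
  obtain c where c: "0 < c"
    "\<And>x u. x \<in> safe_set D \<Longrightarrow> u \<in> U \<Longrightarrow> r / 4 \<le> infdist x G \<Longrightarrow> c \<le> l x u"
  proof -
    let ?F = "(safe_set D \<inter> {x. r / 4 \<le> infdist x G}) \<times> U"
    have "compact ?F"
      using compact_safe_set[OF fin] U
      by (intro compact_Times compact_Int_closed closed_Collect_le continuous_intros)
    moreover have "?F \<subseteq> X \<times> U" using safe_set_subset[OF D(1)] by auto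
    then have "continuous_on ?F (\<lambda>(x, u). l x u)" by (rule continuous_on_subset[OF l(1)])
    moreover have pos: "0 < l x u" if "(x, u) \<in> ?F" for x u
    proof -
      have "x \<notin> G" using that r(1) by (auto simp: infdist_zero)
      then show ?thesis using that safe_set_subset[OF D(1)] by (intro l(3)) auto
    qed
    ultimately show ?thesis
    proof (cases "?F = {}")
      case True
      show ?thesis by (rule that[of 1]) (use True in auto)
    next
      case False
      from continuous_attains_inf[OF \<open>compact ?F\<close> False \<open>continuous_on ?F _\<close>]
      obtain z where z: "z \<in> ?F" "\<And>z'. z' \<in> ?F \<Longrightarrow> (case z of (x, u) \<Rightarrow> l x u) \<le> (case z' of (x, u) \<Rightarrow> l x u)"
        by blast
      obtain y v where "z = (y, v)" by (cases z)
      with z have yv: "(y, v) \<in> ?F" "\<And>x u. (x, u) \<in> ?F \<Longrightarrow> l y v \<le> l x u" by force+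
      show ?thesis by (rule that[of "l y v"]) (use pos[OF yv(1)] yv(2) in auto)
    qed
  qed
  show ?thesis
  proof (rule prob_state_in_target_tendsto_1[where w = w and p = p and f = f and S = "safe_set D"
        and q = q and C = C and c = c and r = r and ?x0.0 = x0])
    fix y assume y: "y \<in> safe_set D"
    have "c * indicator {z. r / 4 \<le> infdist z G} y \<le> l y (us y)"
      using c(2)[OF y] inputsD(1,2)[OF us_in[OF y]] l(2) by (auto simp: indicator_def)
    then show "(LINT v|p. q (f y + v)) \<le> q y - c * indicator {z. r / 4 \<le> infdist z G} y"
      using step[OF y] by linarith
  next
    show "q y \<le> C" for y using C[of y] by simp
  qed (use iid f_meas x0 f_safe r W(1) convex_G G(2) compact_imp_closed[OF G(1)] invariant q_meas q_nonneg c(1)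
      in \<open>auto simp: f_def\<close>)
qed

end

theorem theorem2:
  fixes A :: "real^'n^'n" and B :: "real^'u^'n" and K :: "real^'n^'u"
    and Hx :: "real^'n^'cx" and hx :: "real^'cx"
    and Hu :: "real^'u^'cu" and hu :: "real^'cu"
    and Hw :: "real^'n^'cw" and hw :: "real^'cw"
    and \<X> \<W> \<O> \<E> :: "(real^'n) set" and \<U> :: "(real^'u) set"
    and xS :: "real^'n"
    and l :: "real^'n \<Rightarrow> real^'u \<Rightarrow> real"
    and p :: "(real^'n) measure" and P :: "'a measure" and w :: "nat \<Rightarrow> 'a \<Rightarrow> real^'n"
    and M :: nat and wt :: "nat \<Rightarrow> real^'n" and \<mu> :: "nat \<Rightarrow> real^'n \<Rightarrow> nat \<Rightarrow> real"
    and pm :: "nat \<Rightarrow> real" and \<delta> :: "real^'n \<Rightarrow> nat \<Rightarrow> real"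
    and T0 :: nat and xbar :: "nat \<Rightarrow> real^'n" and ubar :: "nat \<Rightarrow> real^'u"
    and Ek :: "nat \<Rightarrow> (real^'n) set" and tube :: "nat \<Rightarrow> real^'n \<Rightarrow> real^'u" and J0 :: "nat \<Rightarrow> real"
    and j :: nat and D :: "nat \<Rightarrow> ('n, 'u) column set"
    and \<pi> :: "nat \<Rightarrow> real^'n \<Rightarrow> real^'u"
    and T :: "nat \<Rightarrow> nat" and wr :: "nat \<Rightarrow> nat \<Rightarrow> real^'n" and xr :: "nat \<Rightarrow> nat \<Rightarrow> real^'n"
    and xW :: "nat \<Rightarrow> nat \<Rightarrow> real^'n \<Rightarrow> real^'n"
  (* constraints *)
  assumes X: "\<X> = {x. Hx *v x \<le> hx}"
    and U: "\<U> = {u. Hu *v u \<le> hu}" "polytope \<U>" "\<U> \<noteq> {}"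
  (* disturbance *)
    and W: "\<W> = {w. Hw *v w \<le> hw}" "polytope \<W>" "0 \<in> interior \<W>"
    and iid: "prob_space P" "prob_space.indep_vars P (\<lambda>_. borel) w UNIV"
      "\<And>k. distr P borel (w k) = p"
    and p: "measure_support p = \<W>" "(LINT w|p. w) = 0"
    and xS: "xS \<in> \<X>"
  (* target set *)
    and O: "\<O> \<subseteq> \<X>" "polytope \<O>" "rel_interior \<O> \<noteq> {}"
      "robust_invariant (A + B ** K) \<W> \<O>"
    and K: "schur_stable (A + B ** K)"
  (* stage cost; the first inclusion says that l is defined on O x KO, its domain being X x U *)
    and KO: "(*v) K ` \<O> \<subseteq> \<U>"
    and l: "(\<lambda>(x, u). l x u) differentiable_on (\<X> \<times> \<U>)"
      "convex_on (\<X> \<times> \<U>) (\<lambda>(x, u). l x u)"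
      "\<And>x u. x \<in> \<O> \<Longrightarrow> u \<in> (*v) K ` \<O> \<Longrightarrow> l x u = 0"
      "\<And>x u. x \<in> \<X> - \<O> \<Longrightarrow> u \<in> \<U> \<Longrightarrow> 0 < l x u"
  (* discretized disturbances; wt is the sequence of all samples, the controller uses the first M *)
    and wt: "\<And>m. wt m \<in> \<W>" "vertices \<W> \<subseteq> wt ` {..<M}"
    and \<mu>: "\<And>N w m. M \<le> N \<Longrightarrow> w \<in> \<W> \<Longrightarrow> m < N \<Longrightarrow> 0 \<le> \<mu> N w m"
      "\<And>N w. M \<le> N \<Longrightarrow> w \<in> \<W> \<Longrightarrow> (\<Sum>m<N. \<mu> N w m) = 1"
      "\<And>N w. M \<le> N \<Longrightarrow> w \<in> \<W> \<Longrightarrow> w = (\<Sum>m<N. \<mu> N w m *\<^sub>R wt m)"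
    and pm: "\<And>m. m < M \<Longrightarrow> set_integrable p \<W> (\<lambda>w. \<mu> M w m)"
      "\<And>m. m < M \<Longrightarrow> pm m = (LINT w:\<W>|p. \<mu> M w m)"
  (* refinement of the samples *)
    and \<delta>: "\<And>w N. w \<in> \<W> \<Longrightarrow> M \<le> N \<Longrightarrow> 0 < \<delta> w N"
      "\<And>w N m. w \<in> \<W> \<Longrightarrow> M \<le> N \<Longrightarrow> m < N \<Longrightarrow> \<mu> N w m \<noteq> 0 \<Longrightarrow> norm (w - wt m) \<le> \<delta> w N"
      "\<And>w M1. w \<in> \<W> \<Longrightarrow> M \<le> M1 \<Longrightarrow> \<exists>N>M1. \<forall>M2\<ge>N. \<delta> w M1 > \<delta> w M2"
  (* tube controller and initial data *)
    and E: "polytope \<E>" "\<E> \<noteq> {}" "robust_invariant (A + B ** K) \<W> \<E>"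
    and xbar: "xbar 0 = xS"
      "\<And>k. k \<le> T0 \<Longrightarrow> xbar (Suc k) = A *v xbar k + B *v ubar k"
      "\<And>k. k \<le> T0 \<Longrightarrow> xbar (Suc k) \<in> \<X> \<ominus> \<E>"
      "xbar (Suc T0) \<in> \<O> \<ominus> \<E>"
    and ubar: "\<And>k. k \<le> T0 \<Longrightarrow> ubar k \<in> \<U> \<ominus> (*v) K ` \<E>"
    and tube: "\<And>k x. tube k x = ubar k + K *v (x - xbar k)"
    and Ek: "\<And>k. Ek k = (\<lambda>e. xbar k + e) ` \<E>" "Ek 0 \<subseteq> \<X>"
    and J0: "J0 (Suc T0) = 0"
      "\<And>k. k \<le> T0 \<Longrightarrow> J0 k = (SUP x\<in>Ek k. l x (tube k x)) + J0 (Suc k)"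
    and D0: "D 0 = (\<lambda>v. (v, K *v v, 0)) ` (vertices \<O> \<union> vertices (Ek (Suc T0))) \<union>
                   (\<Union>k\<le>T0. (\<lambda>v. (v, tube k v, J0 k)) ` vertices (Ek k))"
  (* MPC policies of the episodes 1, ..., j *)
    and j: "1 \<le> j"
    and \<pi>: "\<And>i x. 1 \<le> i \<Longrightarrow> i \<le> j \<Longrightarrow> mpc_inputs A B \<X> \<U> \<W> (D (i - 1)) x \<noteq> {} \<Longrightarrow>
               is_arg_min (mpc_objective A B l M pm wt (D (i - 1)) x)
                 (\<lambda>u. u \<in> mpc_inputs A B \<X> \<U> \<W> (D (i - 1)) x) (\<pi> i x)"
      "\<pi> j \<in> borel_measurable borel"
  (* realization of the completed episodes 1, ..., j - 1 and data updates *)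
    and xr: "\<And>i k. 1 \<le> i \<Longrightarrow> i < j \<Longrightarrow> k < T i \<Longrightarrow> wr i k \<in> \<W>"
      "\<And>i k. 1 \<le> i \<Longrightarrow> i < j \<Longrightarrow> k \<le> T i \<Longrightarrow> xr i k = closed_loop A B (\<pi> i) xS (wr i) k"
      "\<And>i. 1 \<le> i \<Longrightarrow> i < j \<Longrightarrow> xr i (T i) \<in> \<O>"
    and xW: "\<And>i k. 1 \<le> i \<Longrightarrow> i < j \<Longrightarrow> k \<le> T i \<Longrightarrow>
               explored A B l \<X> \<U> Hu hu \<W> M pm wt (D (i - 1)) (xr i k) (\<pi> i (xr i k)) (xW i k)"
    and D: "\<And>i. 1 \<le> i \<Longrightarrow> i < j \<Longrightarrow>
              D i = D (i - 1) \<union>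
                (\<lambda>x. (x, \<pi> i x, mpc_value A B l \<X> \<U> \<W> M pm wt (D (i - 1)) x)) `
                  (xr i ` {..T i} \<union> (\<Union>k\<le>T i. xW i k ` vertices \<W>))"
  shows "(\<lambda>k. measure P {\<omega> \<in> space P. closed_loop A B (\<pi> j) xS (\<lambda>k. w k \<omega>) k \<in> \<O>})
           \<longlonglongrightarrow> 1"
proof -
  interpret P: prob_space P by (rule iid(1))
  have w_meas: "w k \<in> borel_measurable P" for k using iid(2) by (auto simp: P.indep_vars_def)
  have p_prob: "prob_space p" and sets_p: "sets p = sets borel"
    using P.prob_space_distr[OF w_meas[of 0]] iid(3)[of 0] by (auto simp: sets_distr)
  interpret p: prob_space p by (rule p_prob)
  have AE_W: "AE v in p. v \<in> \<W>" using AE_in_measure_support[OF sets_p] p(1) by simp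
  have zero_W: "0 \<in> \<W>" using W(3) interior_subset by blast
  have W_meas: "\<W> \<in> sets p"
    using W(2) by (simp add: sets_p polytope_imp_closed)
  have pm_nonneg: "0 \<le> pm m" if "m < M" for m
    unfolding pm(2)[OF that] set_lebesgue_integral_def
    using \<mu>(1)[of M _ m] that by (intro Bochner_Integration.integral_nonneg) (auto simp: indicator_def)
  \<comment> \<open>Almost every disturbance lies in \<open>\<W>\<close>, where the weights sum to
    1.\<close>
  have "(\<Sum>m<M. pm m) = (\<Sum>m<M. (LINT v|p. indicator \<W> v *\<^sub>R \<mu> M v m))"
    using pm(2) by (simp add: set_lebesgue_integral_def)
  also have "\<dots> = (LINT v|p. (\<Sum>m<M. indicator \<W> v *\<^sub>R \<mu> M v m))"
    using pm(1) by (intro Bochner_Integration.integral_sum[symmetric]) (auto simp: set_integrable_def)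
  also have "\<dots> = (LINT v|p. 1)"
  proof (rule integral_cong_AE)
    show "(\<lambda>v. \<Sum>m<M. indicator \<W> v *\<^sub>R \<mu> M v m) \<in> borel_measurable p"
      using pm(1) by (intro borel_measurable_sum borel_measurable_integrable) (auto simp: set_integrable_def)
    show "AE v in p. (\<Sum>m<M. indicator \<W> v *\<^sub>R \<mu> M v m) = 1"
      using AE_W by eventually_elim (use \<mu>(2)[of M] in auto)
  qed simp
  also have "\<dots> = 1" using p.prob_space by simp
  finally have pm_sum: "(\<Sum>m<M. pm m) = 1" .
  have G_ne: "\<O> \<noteq> {}" using O(3) by auto
  interpret mpc_problem A B \<X> \<W> \<O> \<U> l M pm wt
  proof
    show "convex \<X>" "convex \<U>" unfolding X U(1) by (rule convex_matrix_halfspaces)+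
    show "\<O> = convex hull vertices \<O>" by (rule polytope_vertices(2)[OF O(2)])
    show "convex \<O>" by (rule polytope_imp_convex[OF O(2)])
  qed (use O(1) wt(1) l(2) pm_nonneg pm_sum in auto)
  have F: "(A + B ** K) *v x = A *v x + B *v (K *v x)" for x
    by (simp add: matrix_vector_mult_add_rdistrib matrix_vector_mul_assoc)
  \<comment> \<open>This puts \<open>xS = xbar 0\<close> into the first tube section and so into the
    initial safe set.\<close>
  have zero_E: "0 \<in> \<E>"
    using zero_in_robust_invariant_set[OF K polytope_imp_compact[OF E(1)] polytope_imp_convex[OF E(1)] E(2,3) zero_W] .
  have Ek_polytope: "polytope (Ek k)" for k
    unfolding Ek(1) using E(1) by (simp add: polytope_translation_eq)
  have Ek_target: "Ek (Suc T0) \<subseteq> \<O>"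
    using xbar(4) by (auto simp: Ek(1) pontryagin_diff_def)
  have Ek_X: "Ek k \<subseteq> \<X>" if "k \<le> T0" for k
  proof (cases k)
    case 0
    then show ?thesis using Ek(2) by simp
  next
    case (Suc i)
    then show ?thesis using xbar(3)[of i] that by (auto simp: Ek(1) pontryagin_diff_def)
  qed
  have tube_U: "tube k x \<in> \<U>" if "k \<le> T0" "x \<in> Ek k" for k x
    using ubar[OF that(1)] that(2) by (auto simp: tube Ek(1) pontryagin_diff_def)
  have tube_step: "A *v x + B *v tube k x + v \<in> Ek (Suc k)" if k: "k \<le> T0" and x: "x \<in> Ek k" and v: "v \<in> \<W>" for k x v
  proof -
    \<comment> \<open>The error \<open>e\<close> relative to the nominal state evolves under
      \<open>A + B ** K\<close> plus the disturbance, which leaves \<open>\<E>\<close>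
      invariant.\<close>
    obtain e where e: "e \<in> \<E>" "x = xbar k + e" using x by (auto simp: Ek(1))
    have "A *v x + B *v tube k x + v = xbar (Suc k) + ((A + B ** K) *v e + v)"
      by (simp add: e(2) tube xbar(2)[OF k] F matrix_vector_right_distrib)
    moreover have "(A + B ** K) *v e + v \<in> \<E>" using E(3) e(1) v by (simp add: robust_invariant_def)
    ultimately show ?thesis by (auto simp: Ek(1))
  qed
  have G_step: "A *v x + B *v (K *v x) + v \<in> \<O>" if "x \<in> \<O>" "v \<in> \<W>" for x v
    using O(4) that by (simp add: robust_invariant_def F)
  have KU: "K *v x \<in> \<U>" if "x \<in> \<O>" for x using KO that by auto
  have l_zero: "l x (K *v y) = 0" if "x \<in> \<O>" "y \<in> \<O>" for x y using l(3) that by blast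
  have l_cont: "continuous_on (\<X> \<times> \<U>) (\<lambda>(x, u). l x u)"
    by (rule differentiable_imp_continuous_on[OF l(1)])
  have J_step: "l x (tube k x) + J0 (Suc k) \<le> J0 k" if k: "k \<le> T0" and x: "x \<in> Ek k" for k x
  proof -
    \<comment> \<open>Continuity on the compact section bounds the stage costs from above, so that
      the supremum in \<open>J0\<close> really dominates each of them.\<close>
    have "continuous_on (Ek k) (tube k)"
      unfolding tube
      by (intro continuous_intros linear_continuous_on_compose[where f = "\<lambda>x. x - xbar k"]) simp
    then have "continuous_on (Ek k) ((\<lambda>(x, u). l x u) \<circ> (\<lambda>x. (x, tube k x)))"
      using Ek_X[OF k] tube_U[OF k]
      by (intro continuous_on_compose continuous_intros continuous_on_subset[OF l_cont]) auto
    then have "compact ((\<lambda>x. l x (tube k x)) ` Ek k)"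
      using polytope_imp_compact[OF Ek_polytope] by (intro compact_continuous_image) (simp_all add: comp_def)
    then have "bdd_above ((\<lambda>x. l x (tube k x)) ` Ek k)"
      by (intro bounded_imp_bdd_above compact_imp_bounded)
    from cSUP_upper[OF x this] show ?thesis using J0(2)[OF k] by simp
  qed
  note init = initial_data[where E = Ek and tube = tube and \<kappa> = "(*v) K" and J = J0 and N = T0,
      folded D0, OF zero_W polytope_vertices(1)[OF O(2)] _ _ polytope_vertices[OF Ek_polytope]
        _ Ek_target _ _ J0(1)]
  have D0_feas: "feasible_data (D 0)"
    by (rule init(1)) (fact KU G_step Ek_X tube_U tube_step)+
  have Ek_safe: "Ek 0 \<subseteq> safe_set (D 0)"
    by (rule init(2)) (fact KU G_step Ek_X tube_U tube_step)+
  have \<pi>_in: "\<pi> i x \<in> inputs (D (i - 1)) x" if "1 \<le> i" "i \<le> j" "inputs (D (i - 1)) x \<noteq> {}" for i x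
    using \<pi>(1)[OF that] by (simp add: is_arg_min_def)
  have xS_init: "xS \<in> safe_set (D 0)"
  proof -
    have "xS \<in> Ek 0" using zero_E xbar(1) by (force simp: Ek(1))
    with Ek_safe show ?thesis by blast
  qed
  have l_nonneg: "0 \<le> l x u" if "\<not> \<X> \<subseteq> \<O>" "x \<in> \<X>" "u \<in> \<U>" for x u
  proof -
    obtain z where "z \<in> \<X> - \<O>" using \<open>\<not> \<X> \<subseteq> \<O>\<close> by blast
    from stage_cost_nonneg[OF convex_X convex_U polytope_imp_compact[OF O(2)] convex_G O(1) this l(1,2)
        l_zero KO l(4) that(2,3)]
    show ?thesis .
  qed
  \<comment> \<open>Induction over the completed episodes. The cost invariant is conditional because
    nonnegativity of the stage cost has been shown only when some admissible state lies outside the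
    target.\<close>
  have data: "feasible_data (D i) \<and> xS \<in> safe_set (D i) \<and> (\<not> \<X> \<subseteq> \<O> \<longrightarrow> costed_data (D i))"
    if "i < j" for i
    using that
  proof (induction i)
    case 0
    have "costed_data (D 0)" if "\<not> \<X> \<subseteq> \<O>"
      by (rule init(3), (fact KU G_step Ek_X tube_U tube_step)+)
        (use l_zero l_nonneg[OF that] l(4) J_step in auto)
    then show ?case using D0_feas xS_init by blast
  next
    case (Suc i)
    then have IH: "feasible_data (D i)" "xS \<in> safe_set (D i)" "\<not> \<X> \<subseteq> \<O> \<Longrightarrow> costed_data (D i)"
      by simp_all
    have i: "1 \<le> Suc i" "Suc i \<le> j" "Suc i < j" using Suc.prems by simp_all
    note \<pi>_in_i = \<pi>_in[OF i(1,2), unfolded diff_Suc_1]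
    let ?V = "xr (Suc i) ` {..T (Suc i)} \<union> (\<Union>k\<le>T (Suc i). xW (Suc i) k ` vertices \<W>)"
    \<comment> \<open>Recorded trajectories are single realizations, so safety is used pathwise, for
      disturbances in \<open>\<W>\<close>. The state at time \<open>k\<close> involves only those
      before \<open>k\<close>.\<close>
    have xr_safe: "xr (Suc i) k \<in> safe_set (D i)" if "k \<le> T (Suc i)" for k
      unfolding xr(2)[OF i(1,3) that]
      using that by (intro closed_loop_safe[OF IH(1) \<pi>_in_i IH(2)] xr(1)[OF i(1,3)]) auto
    have V_ne: "inputs (D i) x \<noteq> {}" if x: "x \<in> ?V" for x
      using x
    proof
      assume "x \<in> xr (Suc i) ` {..T (Suc i)}"
      then show ?thesis using xr_safe inputs_nonempty[OF IH(1)] by blast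
    next
      assume "x \<in> (\<Union>k\<le>T (Suc i). xW (Suc i) k ` vertices \<W>)"
      then obtain k v where kv: "k \<le> T (Suc i)" "v \<in> vertices \<W>" "x = xW (Suc i) k v" by blast
      show ?thesis
        unfolding kv(3) by (rule explored_feasible[OF IH(1) xW[OF i(1,3) kv(1), unfolded diff_Suc_1] kv(2)])
    qed
    have V_fin: "finite ?V" using polytope_vertices(1)[OF W(2)] by simp
    have V_in: "\<pi> (Suc i) x \<in> inputs (D i) x" if "x \<in> ?V" for x
      by (rule \<pi>_in_i[OF V_ne[OF that]])
    have V_cost: "mpc_value A B l \<X> \<U> \<W> M pm wt (D i) x = objective (D i) x (\<pi> (Suc i) x)" if "x \<in> ?V" for x
      by (rule mpc_value_eq[OF \<pi>(1)[OF i(1,2), unfolded diff_Suc_1, OF V_ne[OF that]]])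
    note D_Suc = D[OF i(1,3), unfolded diff_Suc_1]
    have "feasible_data (D (Suc i))"
      unfolding D_Suc by (rule feasible_data_update[OF IH(1) V_fin V_in])
    moreover have "costed_data (D (Suc i))" if "\<not> \<X> \<subseteq> \<O>"
      unfolding D_Suc
      by (rule costed_data_update[OF IH(1) IH(3)[OF that] V_fin V_in V_cost l_nonneg[OF that] l(4)])
    moreover have "xS \<in> safe_set (D (Suc i))"
      using IH(2) safe_set_mono[of "D i" "D (Suc i)"] D_Suc by blast
    ultimately show ?case by blast
  qed
  have j1: "j - 1 < j" using j by simp
  have D_feas: "feasible_data (D (j - 1))" and xS_safe: "xS \<in> safe_set (D (j - 1))"
    using data[OF j1] by simp_all
  show ?thesis
  proof (cases "\<X> \<subseteq> \<O>")
    case True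
    have "AE \<omega> in P. \<forall>k. closed_loop A B (\<pi> j) xS (\<lambda>k. w k \<omega>) k \<in> safe_set (D (j - 1))"
    proof (rule P.AE_invariant_state[OF w_meas iid(3) _ _ AE_W xS_safe,
          where f = "\<lambda>y. A *v y + B *v \<pi> j y"])
      fix y v assume y: "y \<in> safe_set (D (j - 1))" and v: "v \<in> \<W>"
      from inputsD(4)[OF \<pi>_in[OF j order_refl inputs_nonempty[OF D_feas y]] v]
      show "A *v y + B *v \<pi> j y + v \<in> safe_set (D (j - 1))" .
    qed simp_all
    then have AE_O: "AE \<omega> in P. closed_loop A B (\<pi> j) xS (\<lambda>k. w k \<omega>) k \<in> \<O>" for k
      using safe_set_subset[OF D_feas] True by (auto elim: eventually_mono)
    have "measure P {\<omega> \<in> space P. closed_loop A B (\<pi> j) xS (\<lambda>k. w k \<omega>) k \<in> \<O>} = 1" for k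
    proof (subst P.prob_Collect_eq_1)
      have [measurable]: "(\<lambda>\<omega>. closed_loop A B (\<pi> j) xS (\<lambda>k. w k \<omega>) k) \<in> borel_measurable P"
        by (rule P.indep_var_rv1[OF P.indep_var_state_disturbance[OF iid(2)
              borel_measurable_linear_feedback[OF \<pi>(2)]]]) simp_all
      have [measurable]: "\<O> \<in> sets borel" using O(2) by (simp add: polytope_imp_closed)
      show "{\<omega> \<in> space P. closed_loop A B (\<pi> j) xS (\<lambda>k. w k \<omega>) k \<in> \<O>} \<in> P.events" by measurable
    qed (rule AE_O)
    then show ?thesis by simp
  next
    case False
    with data[OF j1] have costed: "costed_data (D (j - 1))" by simp
    show ?thesis
      by (rule closed_loop_reaches_target[OF D_feas costed xS_safe \<pi>(1)[OF j order_refl] \<pi>(2) iid p(1) W(3)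
          polytope_imp_compact[OF U(2)] polytope_imp_compact[OF O(2)] G_ne
          \<mu>(1)[OF order_refl] \<mu>(2)[OF order_refl] \<mu>(3)[OF order_refl] pm l_cont l_nonneg[OF False] l(4)])
  qed
qed

end
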